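(* Let $n\ge 2$, let $b(x)=\frac{1}{2n}x^{2n}+\sum_{j=2}^{2n-1}a_jx^j$ with real coefficients $a_j$, and let $\Omega=\{(z_1,z_2)\in\mathbb{C}^2:\operatorname{Im} z_2>b(\operatorname{Re} z_1)\}$. Write points of $\mathbb{C}^2$ as $z=(z_1,z_2)=(x+iy,\;t+ib(x)+ih)$ and $w=(w_1,w_2)=(r+is,\;u+ib(r)+ik)$ with $x,y,t,h,r,s,u,k\in\mathbb{R}$. Then the integral $$S(z,w)=c\iint_{\tau>0}\tau\, e^{\eta\tau[z_1+\bar w_1]+i\tau[z_2-\bar w_2]}\,[N(\eta,\tau)]^{-1}\,d\eta\,d\tau$$ defining the Szegő kernel of $\Omega$ is absolutely convergent in the region of those $(z,w)\in\mathbb{C}^2\times\mathbb{C}^2$ for which $$h+k+b(x)+b(r)-2b^{**}\!\left(\frac{x+r}{2}\right)>0 .$$ This region is an open neighborhood of $(\overline{\Omega}\times\overline{\Omega})\setminus\Sigma$. More generally, if $i_1,j_1,i_2,j_2$ are non-negative integers, then $$\partial_{z_1}^{i_1}\partial_{\bar w_1}^{j_1}\partial_{z_2}^{i_2}\partial_{\bar w_2}^{j_2}S(z,w)=c'\iint_{\tau>0}e^{\eta\tau[z_1+\bar w_1]+i\tau[z_2-\bar w_2]}\,\frac{\eta^{i_1+j_1}\,\tau^{i_1+j_1+i_2+j_2+1}}{N(\eta,\tau)}\,d\eta\,d\tau$$ (with $c'$ a constant), and this integral is absolutely convergent in the same region.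
   Context: For $\eta\in\mathbb{R}$ and $\tau>0$, $N(\eta,\tau)=\int_{-\infty}^{\infty}e^{2\tau[\eta\lambda-b(\lambda)]}\,d\lambda$. The variable $\eta$ ranges over $\mathbb{R}$ and $\tau$ over $(0,\infty)$ in the integrals; $c$ is an absolute constant. For $\eta\in\mathbb{R}$ set $B_\eta(x)=-\eta x+b(x)$ and let $\Lambda_\eta=\{\lambda\in\mathbb{R}:\inf_xB_\eta(x)=B_\eta(\lambda)\}$ be the set of global minimizers of $B_\eta$. Set $\Lambda=\bigcup_{\eta\in\mathbb{R}}\Lambda_\eta$ and $\mathcal{C}=\{\eta\in\mathbb{R}:|\Lambda_\eta|>1\}$. With $z=(z_1,z_2)=(x+iy,\;t+ib(x)+ih)$ and $w=(w_1,w_2)=(r+is,\;u+ib(r)+ik)$, where $x,y,t,h,r,s,u,k\in\mathbb{R}$, $$\Sigma=\{(z,w):x=r\text{ and }x\in\Lambda\}\cup\{(z,w):x,r\in\Lambda_c\text{ for some }c\in\mathcal{C}\}.$$ The Legendre transform of a continuous function $f$ on $\mathbb{R}$ is $f^*(\eta)=\sup_{x\in\mathbb{R}}[\eta x-f(x)]$, and $b^{**}=(b^* )^*$. The Szegő kernel is the reproducing kernel (with respect to $L^2(\partial\Omega)$, $\partial\Omega$ being identified with $\mathbb{R}^3$ via $(x,y,t)\mapsto(x+iy,t+ib(x))$ and Lebesgue measure) of the space $\mathcal{H}^2(\Omega)$ of holomorphic $F$ on $\Omega$ with $\sup_{\varepsilon>0}\int_{\mathbb{R}^3}|F(x+iy,t+ib(x)+i\varepsilon)|^2\,dx\,dy\,dt<\infty$;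 for these domains it is given by the integral formula for $S$ in the claim. *)

theory Defs
  imports "HOL-Analysis.Analysis"
begin

text \<open>
  Throughout, a function \<open>b :: real \<Rightarrow> real\<close> defines the tube-like domain
  \<open>Im z\<^sub>2 > b (Re z\<^sub>1)\<close> in \<open>complex \<times> complex\<close>.
\<close>

definition Omega :: "(real \<Rightarrow> real) \<Rightarrow> (complex \<times> complex) set" where
  "Omega b = {z. Im (snd z) > b (Re (fst z))}"

text \<open>
  The coordinate \<open>h\<close> of a point written as \<open>z = (x + iy, t + i b(x) + i h)\<close>.
\<close>

definition height :: "(real \<Rightarrow> real) \<Rightarrow> complex \<times> complex \<Rightarrow> real" where
  "height b z = Im (snd z) - b (Re (fst z))"

definition N :: "(real \<Rightarrow> real) \<Rightarrow> real \<Rightarrow> real \<Rightarrow> real" where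
  "N b \<eta> \<tau> = (LINT x|lborel. exp (2 * \<tau> * (\<eta> * x - b x)))"

text \<open>
  The supremum is taken in the reals, so the Legendre transform is meaningful only where it is
  finite. This is so everywhere for \<open>f\<close> continuous of superlinear growth at both ends, and
  then the transform is again continuous of superlinear growth.
\<close>

definition legendre :: "(real \<Rightarrow> real) \<Rightarrow> real \<Rightarrow> real" where
  "legendre f \<eta> = (SUP x. \<eta> * x - f x)"

definition B :: "(real \<Rightarrow> real) \<Rightarrow> real \<Rightarrow> real \<Rightarrow> real" where
  "B b \<eta> x = - \<eta> * x + b x"

definition Lambda_at :: "(real \<Rightarrow> real) \<Rightarrow> real \<Rightarrow> real set" where
  "Lambda_at b \<eta> = {y. (INF x. B b \<eta> x) = B b \<eta> y}"

definition Lambda :: "(real \<Rightarrow> real) \<Rightarrow> real set" where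
  "Lambda b = (\<Union>\<eta>. Lambda_at b \<eta>)"

text \<open>
  For a nonconstant polynomial \<open>b\<close> that is bounded below the sets \<^term>\<open>Lambda_at b \<eta>\<close> are finite (they
  consist of critical points), so \<^const>\<open>card\<close> is the true cardinality.
\<close>

definition C_set :: "(real \<Rightarrow> real) \<Rightarrow> real set" where
  "C_set b = {\<eta>. card (Lambda_at b \<eta>) > 1}"

definition Sigma_set ::
  "(real \<Rightarrow> real) \<Rightarrow> ((complex \<times> complex) \<times> (complex \<times> complex)) set" where
  "Sigma_set b =
     {(z, w). Re (fst z) = Re (fst w) \<and> Re (fst z) \<in> Lambda b} \<union>
     {(z, w). \<exists>\<eta>\<in>C_set b. Re (fst z) \<in> Lambda_at b \<eta> \<and> Re (fst w) \<in> Lambda_at b \<eta>}"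

definition region ::
  "(real \<Rightarrow> real) \<Rightarrow> ((complex \<times> complex) \<times> (complex \<times> complex)) set" where
  "region b = {(z, w).
     height b z + height b w + b (Re (fst z)) + b (Re (fst w))
       - 2 * legendre (legendre b) ((Re (fst z) + Re (fst w)) / 2) > 0}"

text \<open>
  The pair \<open>(\<eta>, \<tau>)\<close> ranges over \<open>UNIV \<times> {0<..}\<close>. Integrals are Lebesgue integrals on the plane,
  and \<^const>\<open>set_integrable\<close> is absolute convergence.
\<close>

definition phase :: "(complex \<times> complex) \<times> (complex \<times> complex) \<Rightarrow> real \<Rightarrow> real \<Rightarrow> complex" where
  "phase p \<eta> \<tau> = (case p of ((z1, z2), (w1, w2)) \<Rightarrow>
     of_real (\<eta> * \<tau>) * (z1 + cnj w1) + \<i> * of_real \<tau> * (z2 - cnj w2))"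

definition szego_integrand ::
  "(real \<Rightarrow> real) \<Rightarrow> (complex \<times> complex) \<times> (complex \<times> complex) \<Rightarrow> real \<times> real \<Rightarrow> complex" where
  "szego_integrand b p = (\<lambda>(\<eta>, \<tau>).
     of_real \<tau> * exp (phase p \<eta> \<tau>) * inverse (of_real (N b \<eta> \<tau>)))"

text \<open>
  The constant \<open>c\<close> depends only on the normalisation of measures; it is \<open>1 / (4 \<pi>\<^sup>2)\<close> for the
  reproducing kernel of the Hardy space with respect to Lebesgue measure in \<open>(x, y, t)\<close>.
\<close>

definition szego ::
  "complex \<Rightarrow> (real \<Rightarrow> real) \<Rightarrow> (complex \<times> complex) \<times> (complex \<times> complex) \<Rightarrow> complex" where
  "szego c b p = c * (LINT q : UNIV \<times> {0<..} | lborel. szego_integrand b p q)"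

definition szego_deriv_integrand ::
  "(real \<Rightarrow> real) \<Rightarrow> nat \<Rightarrow> nat \<Rightarrow> nat \<Rightarrow> nat \<Rightarrow>
     (complex \<times> complex) \<times> (complex \<times> complex) \<Rightarrow> real \<times> real \<Rightarrow> complex" where
  "szego_deriv_integrand b i1 j1 i2 j2 p = (\<lambda>(\<eta>, \<tau>).
     exp (phase p \<eta> \<tau>) *
     of_real (\<eta> ^ (i1 + j1) * \<tau> ^ (i1 + j1 + i2 + j2 + 1) / N b \<eta> \<tau>))"

text \<open>
  Wirtinger derivatives \<open>(\<partial>\<^sub>x - i \<partial>\<^sub>y) / 2\<close> and \<open>(\<partial>\<^sub>x + i \<partial>\<^sub>y) / 2\<close> in one complex variable
  \<open>x + iy\<close>; the argument \<open>e\<close> is the inclusion of the corresponding complex coordinate axis.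
\<close>

definition real_partial ::
  "'a::real_normed_vector \<Rightarrow> ('a \<Rightarrow> complex) \<Rightarrow> 'a \<Rightarrow> complex" where
  "real_partial v f p = vector_derivative (\<lambda>s. f (p + s *\<^sub>R v)) (at 0)"

definition wirtinger ::
  "(complex \<Rightarrow> 'a::real_normed_vector) \<Rightarrow> ('a \<Rightarrow> complex) \<Rightarrow> 'a \<Rightarrow> complex" where
  "wirtinger e f p = (real_partial (e 1) f p - \<i> * real_partial (e \<i>) f p) / 2"

definition wirtinger_bar ::
  "(complex \<Rightarrow> 'a::real_normed_vector) \<Rightarrow> ('a \<Rightarrow> complex) \<Rightarrow> 'a \<Rightarrow> complex" where
  "wirtinger_bar e f p = (real_partial (e 1) f p + \<i> * real_partial (e \<i>) f p) / 2"

definition mixed_deriv ::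
  "nat \<Rightarrow> nat \<Rightarrow> nat \<Rightarrow> nat \<Rightarrow>
     ((complex \<times> complex) \<times> (complex \<times> complex) \<Rightarrow> complex) \<Rightarrow>
     (complex \<times> complex) \<times> (complex \<times> complex) \<Rightarrow> complex" where
  "mixed_deriv i1 j1 i2 j2 f =
     (wirtinger (\<lambda>\<zeta>. ((\<zeta>, 0), (0, 0))) ^^ i1)
       ((wirtinger_bar (\<lambda>\<zeta>. ((0, 0), (\<zeta>, 0))) ^^ j1)
         ((wirtinger (\<lambda>\<zeta>. ((0, \<zeta>), (0, 0))) ^^ i2)
           ((wirtinger_bar (\<lambda>\<zeta>. ((0, 0), (0, \<zeta>))) ^^ j2) f)))"

end

theory Submission
  imports Defs
begin

text \<open>
  Write \<open>b\<^sup>*\<close> for the Legendre transform of \<open>b\<close>. For a pair of points \<open>p = (z, w)\<close> with real parts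
  \<open>x\<close> and \<open>r\<close> of the first coordinates, the Szego integrand has modulus
  \<open>\<tau> exp (\<tau> (\<eta> (x + r) - Im z\<^sub>2 - Im w\<^sub>2)) / N b \<eta> \<tau>\<close>. By Laplace's method \<open>N b \<eta> \<tau>\<close> is
  \<open>exp (2 \<tau> b\<^sup>*(\<eta>))\<close> up to algebraic factors, so everything is governed by the rate
  \<open>exponent p \<eta> = \<eta> (x + r) - Im z\<^sub>2 - Im w\<^sub>2 - 2 b\<^sup>*(\<eta>)\<close>.

  Maximizing the rate over \<open>\<eta>\<close> produces the second transform \<open>b\<^sup>*\<^sup>*\<close> at the midpoint, and the region is
  exactly the set where the rate is negative for all \<open>\<eta>\<close> (\<open>region_iff_exponent_neg\<close>). As \<open>b\<^sup>*\<close> is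
  superlinear, negativity improves to \<open>exponent p \<eta> \<le> - \<epsilon> (1 + \<bar>\<eta>\<bar>)\<close> for some \<open>\<epsilon> > 0\<close>
  (\<open>exponent_uniformly_neg\<close>), an estimate that survives small changes of \<open>p\<close>. Hence the region is
  open. A point over the closed domain where the rate is nonnegative for some \<open>\<eta>\<close> forces \<open>x\<close> and \<open>r\<close> to be
  minimizers of \<open>B b \<eta>\<close> simultaneously, and this is the description of the exceptional set
  (\<open>closure_minus_Sigma_subset_region\<close>).

  Exponential decay settles large \<open>\<tau>\<close> and large \<open>\<eta>\<close>, but as \<open>\<tau>\<close> tends to \<open>0\<close> the \<open>\<eta>\<close>-integral spreads
  out to size \<open>1 / \<tau>\<close>, and there the algebraic factors matter. A second-order expansion of \<open>b\<close> at a
  maximizer shows that \<open>exp (2 \<tau> b\<^sup>*(\<eta>)) / N b \<eta> \<tau>\<close> is at most of the order of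
  \<open>(1 + \<tau>) sqrt (1 + \<bar>\<eta>\<bar>)\<close> (\<open>N_lower_bound\<close>). Growth slower than \<open>1 + \<bar>\<eta>\<bar>\<close> is what makes the
  integrals converge at \<open>\<tau> = 0\<close> (\<open>weight_le_product_majorant\<close>).

  For the derivatives, the phase is real-linear in \<open>p\<close>, so each derivative multiplies the
  integrand by \<open>\<eta> \<tau>\<close> or \<open>\<plusminus> \<i> \<tau>\<close> and stays within one family of moment integrals. The bound
  \<open>norm (exp u - 1 - u) \<le> (norm u)\<^sup>2 exp (norm u)\<close>, applied to the increment \<open>u\<close> of the phase, is
  integrable against the integrand by the same estimate, and this yields the total derivative of
  every moment (\<open>moment_has_derivative\<close>). The formula for the mixed derivatives is then an iteration
  on the open region (\<open>mixed_deriv_szego\<close>).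
\<close>

section \<open>Integrable majorants on the half-plane\<close>

lemma polynomial_times_exp_decay_bounded:
  fixes \<epsilon> :: real
  assumes "\<epsilon> > 0"
  shows "\<exists>C\<ge>0. \<forall>s\<ge>0. (1 + s) ^ k * exp (- \<epsilon> * s) \<le> C"
proof -
  define d where "d = \<epsilon> / real (Suc k)"
  have d: "d > 0" using assms by (simp add: d_def)
  have "(1 + s) ^ k * exp (- \<epsilon> * s) \<le> exp \<epsilon> / d ^ Suc k" if s: "s \<ge> 0" for s
  proof -
    have "d * (1 + s) \<le> exp (d * (1 + s))"
      using exp_ge_add_one_self[of "d * (1 + s)"] by linarith
    then have "(d * (1 + s)) ^ Suc k \<le> exp (d * (1 + s)) ^ Suc k"
      by (intro power_mono) (use d s in auto)
    also have "\<dots> = exp (real (Suc k) * (d * (1 + s)))"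
      by (rule exp_of_nat_mult[symmetric])
    also have "real (Suc k) * (d * (1 + s)) = \<epsilon> + \<epsilon> * s"
      by (simp add: d_def field_simps)
    finally have "d ^ Suc k * (1 + s) ^ Suc k \<le> exp \<epsilon> * exp (\<epsilon> * s)"
      by (simp only: power_mult_distrib exp_add)
    then have "(1 + s) ^ Suc k \<le> exp \<epsilon> * exp (\<epsilon> * s) / d ^ Suc k"
      using d by (subst pos_le_divide_eq) (simp_all only: zero_less_power mult.commute)
    moreover have "(1 + s) ^ k \<le> (1 + s) ^ Suc k"
      using s by (intro power_increasing) auto
    ultimately show ?thesis
      by (simp add: exp_minus field_simps)
  qed
  moreover have "exp \<epsilon> / d ^ Suc k \<ge> 0" using d by simp
  ultimately show ?thesis by blast
qed

text \<open>
  The two powers are the ones left over when the weight of \<open>weight_le_product_majorant\<close> is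
  split into a function of \<open>\<eta>\<close> times a function of \<open>\<tau>\<close>. Both are integrable: the first since
  \<open>5/4 > 1\<close>, the second since its exponent is above \<open>-1\<close> near \<open>0\<close> and below \<open>-1\<close> near infinity.
\<close>

definition frequency_majorant :: "real \<Rightarrow> real" where
  "frequency_majorant x = (1 + \<bar>x\<bar>) powr (- 5/4)"

definition dilation_majorant :: "real \<Rightarrow> real" where
  "dilation_majorant t =
     indicator {0..1} t * t powr (- 3/4) + indicator {1..} t * t powr (- 5/4)"

lemma frequency_majorant_measurable [measurable]: "frequency_majorant \<in> borel_measurable borel"
  unfolding frequency_majorant_def by measurable

lemma dilation_majorant_measurable [measurable]: "dilation_majorant \<in> borel_measurable borel"
  unfolding dilation_majorant_def by measurable

lemma majorant_nonneg [simp]: "frequency_majorant x \<ge> 0" "dilation_majorant t \<ge> 0"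
  by (auto simp: frequency_majorant_def dilation_majorant_def)

lemma integrable_power_tail:
  "integrable lborel (\<lambda>t::real. indicator {1..} t * t powr (- 5/4))"
proof -
  have "(\<lambda>t::real. t powr (- 5/4)) absolutely_integrable_on {1..}"
    by (rule nonnegative_absolutely_integrable_1)
       (use has_integral_powr_to_inf[of "- 5/4" 1] in \<open>auto simp: integrable_on_def\<close>)
  then show ?thesis by (simp add: set_integrable_def integrable_completion)
qed

lemma integrable_dilation_majorant: "integrable lborel dilation_majorant"
proof -
  have "(\<lambda>t::real. t powr (- 3/4)) absolutely_integrable_on {0..1}"
    by (rule nonnegative_absolutely_integrable_1)
       (use integrable_on_powr_from_0[of "- 3/4" 1] in auto)
  then have "integrable lborel (\<lambda>t::real. indicator {0..1} t * t powr (- 3/4))"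
    by (simp add: set_integrable_def integrable_completion)
  then show ?thesis
    unfolding dilation_majorant_def using integrable_power_tail
    by (rule Bochner_Integration.integrable_add)
qed

lemma integrable_frequency_majorant: "integrable lborel frequency_majorant"
proof -
  define k where "k = (\<lambda>t::real. indicator {1..} t * t powr (- 5/4))"
  have k: "integrable lborel k" unfolding k_def by (rule integrable_power_tail)
  have "integrable lborel (\<lambda>x. k (1 + 1 * x) + k (1 + (-1) * x))"
    by (intro Bochner_Integration.integrable_add lborel_integrable_real_affine k) auto
  then show ?thesis
  proof (rule Bochner_Integration.integrable_bound)
    show "AE x in lborel. norm (frequency_majorant x) \<le> norm (k (1 + 1 * x) + k (1 + (-1) * x))"
    proof (rule AE_I2)
      fix x :: real
      show "norm (frequency_majorant x) \<le> norm (k (1 + 1 * x) + k (1 + (-1) * x))"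
        by (cases "x \<ge> 0") (auto simp: frequency_majorant_def k_def indicator_def)
    qed
  qed simp
qed

lemma integrable_product_majorant:
  "integrable lborel (\<lambda>(\<eta>, \<tau>). frequency_majorant \<eta> * dilation_majorant \<tau>)"
proof -
  have "integrable (lborel \<Otimes>\<^sub>M lborel) (\<lambda>(\<eta>, \<tau>). frequency_majorant \<eta> * dilation_majorant \<tau>)"
    by (rule lborel_pair.Fubini_integrable)
       (auto simp: norm_mult abs_mult integrable_frequency_majorant integrable_dilation_majorant)
  then show ?thesis by (simp add: lborel_prod)
qed

text \<open>
  This is where convergence at small \<open>\<tau>\<close> is decided. Put \<open>v = 1 + \<bar>\<eta>\<bar>\<close> and \<open>s = \<tau> v\<close>. Since \<open>\<tau> \<le> s\<close>
  and \<open>m < l\<close>, every power of \<open>v\<close> other than \<open>sqrt v\<close> can be paired with a power of \<open>\<tau>\<close>, so the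
  weight is at most \<open>(1 + s) ^ l exp (- \<epsilon> s)\<close> times \<open>\<tau> sqrt v\<close>. The first factor decays faster than
  every power of \<open>s\<close>; trading it for \<open>s powr (- 7/4)\<close> when \<open>\<tau> \<le> 1\<close> and for \<open>s powr (- 9/4)\<close>
  when \<open>\<tau> > 1\<close> leaves a product of integrable functions. The argument tolerates any
  \<open>v\<close>-exponent below \<open>1\<close> in place of the \<open>1/2\<close> of the square root, but not \<open>1\<close> itself.
\<close>

lemma weight_le_product_majorant:
  fixes \<epsilon> :: real and m l :: nat
  assumes "\<epsilon> > 0" and "m < l"
  shows "\<exists>C\<ge>0. \<forall>\<eta>. \<forall>\<tau>>0.
    (1 + \<bar>\<eta>\<bar>) ^ m * \<tau> ^ l * exp (- \<epsilon> * (\<tau> * (1 + \<bar>\<eta>\<bar>))) * ((1 + \<tau>) * sqrt (1 + \<bar>\<eta>\<bar>))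
      \<le> C * (frequency_majorant \<eta> * dilation_majorant \<tau>)"
proof -
  obtain C where C: "C \<ge> 0" "\<And>s. s \<ge> 0 \<Longrightarrow> (1 + s) ^ (l + 3) * exp (- \<epsilon> * s) \<le> C"
    using polynomial_times_exp_decay_bounded[OF assms(1), of "l + 3"] by blast
  have "(1 + \<bar>\<eta>\<bar>) ^ m * \<tau> ^ l * exp (- \<epsilon> * (\<tau> * (1 + \<bar>\<eta>\<bar>))) * ((1 + \<tau>) * sqrt (1 + \<bar>\<eta>\<bar>))
      \<le> C * (frequency_majorant \<eta> * dilation_majorant \<tau>)" if \<tau>: "\<tau> > 0" for \<eta> \<tau> :: real
  proof -
    define v where "v = 1 + \<bar>\<eta>\<bar>"
    define s where "s = \<tau> * v"
    have v: "v \<ge> 1" by (simp add: v_def)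
    have s: "s > 0" "\<tau> \<le> s" using v \<tau> by (auto simp: s_def)
    have pow: "(1 + s) ^ l * exp (- \<epsilon> * s) \<le> C * s powr (- r)" if r: "0 \<le> r" "r \<le> 3" for r
    proof -
      have "s powr r \<le> (1 + s) powr r" using s r by (intro powr_mono2) auto
      also have "\<dots> \<le> (1 + s) powr 3" using s r by (intro powr_mono) auto
      also have "\<dots> = (1 + s) ^ 3" using s by (simp add: powr_numeral)
      finally have "(1 + s) ^ l * exp (- \<epsilon> * s) * s powr r \<le> (1 + s) ^ l * exp (- \<epsilon> * s) * (1 + s) ^ 3"
        using s by (intro mult_left_mono) auto
      also have "\<dots> \<le> C" using C(2)[of s] s by (simp add: power_add mult_ac)
      finally show ?thesis using s by (simp add: powr_minus field_simps)
    qed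
    obtain j where j: "l = m + j + 1" using assms(2) less_imp_Suc_add by fastforce
    (* Each of the \<open>m\<close> factors \<open>v\<close> is absorbed together with one factor \<open>\<tau>\<close>; one further \<open>\<tau>\<close> is kept. *)
    have "v ^ m * \<tau> ^ l * (1 + \<tau>) = s ^ m * \<tau> ^ j * (1 + \<tau>) * \<tau>"
      by (simp add: j s_def power_add power_mult_distrib)
    also have "\<dots> \<le> (1 + s) ^ m * (1 + s) ^ j * (1 + s) * \<tau>"
      using s \<tau> by (intro mult_mono power_mono mult_nonneg_nonneg) auto
    also have "\<dots> = (1 + s) ^ l * \<tau>" by (simp add: j power_add)
    finally have "v ^ m * \<tau> ^ l * (1 + \<tau>) * (exp (- \<epsilon> * s) * sqrt v)
        \<le> (1 + s) ^ l * \<tau> * (exp (- \<epsilon> * s) * sqrt v)"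
      using v by (intro mult_right_mono) auto
    then have 1: "v ^ m * \<tau> ^ l * exp (- \<epsilon> * s) * ((1 + \<tau>) * sqrt v)
        \<le> (1 + s) ^ l * exp (- \<epsilon> * s) * (\<tau> * sqrt v)"
      by (simp add: mult_ac)
    have 2: "(1 + s) ^ l * exp (- \<epsilon> * s) * (\<tau> * sqrt v) \<le> C * s powr (- r) * (\<tau> * sqrt v)"
      if "0 \<le> r" "r \<le> 3" for r
      using pow[OF that] \<tau> v by (intro mult_right_mono) auto
    have 3: "C * s powr (- r) * (\<tau> * sqrt v) = C * (v powr (1/2 - r) * \<tau> powr (1 - r))" for r
    proof -
      have "sqrt v = v powr (1/2)" using v by (simp add: powr_half_sqrt)
      moreover have "\<tau> powr (1 - r) = \<tau> * \<tau> powr (- r)"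
        using \<tau> powr_add[of \<tau> 1 "- r"] by simp
      moreover have "v powr (1/2 - r) = v powr (1/2) * v powr (- r)"
        using powr_add[of v "1/2" "- r"] by simp
      moreover have "s powr (- r) = \<tau> powr (- r) * v powr (- r)"
        using \<tau> v by (simp add: s_def powr_mult)
      ultimately show ?thesis by (simp add: mult_ac)
    qed
    have "C * s powr (- (if \<tau> \<le> 1 then 7/4 else 9/4)) * (\<tau> * sqrt v)
        \<le> C * (frequency_majorant \<eta> * dilation_majorant \<tau>)"
    proof (cases "\<tau> \<le> 1")
      case True
      have "\<tau> powr (- 3/4) \<le> dilation_majorant \<tau>"
        using True \<tau> by (simp add: dilation_majorant_def indicator_def)
      then have le: "v powr (- 5/4) * \<tau> powr (- 3/4) \<le> frequency_majorant \<eta> * dilation_majorant \<tau>"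
        by (simp add: frequency_majorant_def v_def mult_left_mono)
      have "C * s powr (- (7/4)) * (\<tau> * sqrt v) = C * (v powr (- 5/4) * \<tau> powr (- 3/4))"
        using 3[of "7/4"] by simp
      also have "\<dots> \<le> C * (frequency_majorant \<eta> * dilation_majorant \<tau>)"
        using le C(1) by (rule mult_left_mono)
      finally show ?thesis using True by simp
    next
      case False
      have "v powr (- 7/4) \<le> v powr (- 5/4)" using v by (intro powr_mono) auto
      moreover have "dilation_majorant \<tau> = \<tau> powr (- 5/4)"
        using False by (simp add: dilation_majorant_def indicator_def)
      ultimately have le: "v powr (- 7/4) * \<tau> powr (- 5/4) \<le> frequency_majorant \<eta> * dilation_majorant \<tau>"
        by (simp add: frequency_majorant_def v_def mult_right_mono)
      have "C * s powr (- (9/4)) * (\<tau> * sqrt v) = C * (v powr (- 7/4) * \<tau> powr (- 5/4))"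
        using 3[of "9/4"] by simp
      also have "\<dots> \<le> C * (frequency_majorant \<eta> * dilation_majorant \<tau>)"
        using le C(1) by (rule mult_left_mono)
      finally show ?thesis using False by simp
    qed
    from order_trans[OF 1 order_trans[OF 2 this]] show ?thesis
      by (simp add: v_def s_def)
  qed
  with C(1) show ?thesis by blast
qed

section \<open>The Legendre transform and the region of convergence\<close>

lemma component_norm_le:
  fixes x :: "'a::real_normed_vector \<times> 'b::real_normed_vector"
  shows "norm (fst x) \<le> norm x" and "norm (snd x) \<le> norm x"
  using norm_fst_le[of "fst x" "snd x"] norm_snd_le[of "snd x" "fst x"] by simp_all

text \<open>
  Under these two assumptions the supremum in the Legendre transform is finite and attained, and the
  transform satisfies them again, so that it can be applied twice.
\<close>

locale superlinear =
  fixes b :: "real \<Rightarrow> real"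
  assumes continuous: "continuous_on UNIV b"
    and superlinear: "\<exists>C. \<forall>x. M * \<bar>x\<bar> - C \<le> b x"
begin

lemma measurable_b [measurable]: "b \<in> borel_measurable borel"
  using continuous by (rule borel_measurable_continuous_onI)

lemma bdd_above_legendre: "bdd_above (range (\<lambda>x. \<eta> * x - b x))"
proof -
  obtain C where C: "\<And>x. \<bar>\<eta>\<bar> * \<bar>x\<bar> - C \<le> b x" using superlinear by blast
  have "\<eta> * x - b x \<le> C" for x
    using C[of x] abs_ge_self[of "\<eta> * x"] by (simp add: abs_mult)
  then show ?thesis by (intro bdd_aboveI2[where M = C])
qed

lemma legendre_ge: "\<eta> * x - b x \<le> legendre b \<eta>"
  unfolding legendre_def by (rule cSUP_upper[OF _ bdd_above_legendre]) simp

lemma legendre_attained: "\<exists>y. legendre b \<eta> = \<eta> * y - b y"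
proof -
  obtain C where C: "\<And>x. (\<bar>\<eta>\<bar> + 1) * \<bar>x\<bar> - C \<le> b x" using superlinear by blast
  (* Outside \<open>{-R..R}\<close> the values fall below the value \<open>- b 0\<close> at \<open>x = 0\<close>. *)
  define R where "R = \<bar>C + b 0\<bar>"
  have "\<exists>y\<in>{-R..R}. \<forall>x\<in>{-R..R}. \<eta> * x - b x \<le> \<eta> * y - b y"
    by (rule continuous_attains_sup)
       (auto intro!: continuous_intros continuous_on_subset[OF continuous] simp: R_def)
  then obtain y where "\<forall>x\<in>{-R..R}. \<eta> * x - b x \<le> \<eta> * y - b y" by blast
  then have y: "\<eta> * x - b x \<le> \<eta> * y - b y" if "\<bar>x\<bar> \<le> R" for x
    using that by (simp add: abs_le_iff minus_le_iff)
  have "\<eta> * x - b x \<le> \<eta> * y - b y" for x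
  proof (cases "\<bar>x\<bar> \<le> R")
    case False
    have "\<eta> * x \<le> \<bar>\<eta>\<bar> * \<bar>x\<bar>" using abs_ge_self[of "\<eta> * x"] by (simp add: abs_mult)
    then have "\<eta> * x - b x \<le> C - \<bar>x\<bar>" using C[of x] by (simp add: algebra_simps)
    also have "\<dots> \<le> - b 0" using False by (simp add: R_def)
    also have "\<dots> \<le> \<eta> * y - b y" using y[of 0] by (simp add: R_def)
    finally show ?thesis .
  qed (rule y)
  then have "legendre b \<eta> = \<eta> * y - b y"
    unfolding legendre_def by (intro cSup_eq_maximum) auto
  then show ?thesis ..
qed

text \<open>
  A pointwise supremum of affine functions is convex, and finite convex functions on the line are
  continuous.
\<close>

lemma continuous_legendre: "continuous_on UNIV (legendre b)"
proof (rule convex_on_continuous)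
  show "convex_on UNIV (legendre b)"
  proof (rule convex_onI)
    fix t \<eta> \<xi> :: real
    assume t: "0 < t" "t < 1"
    obtain y where y: "legendre b ((1 - t) *\<^sub>R \<eta> + t *\<^sub>R \<xi>) = ((1 - t) *\<^sub>R \<eta> + t *\<^sub>R \<xi>) * y - b y"
      using legendre_attained by blast
    also have "\<dots> = (1 - t) * (\<eta> * y - b y) + t * (\<xi> * y - b y)"
      by (simp add: algebra_simps)
    also have "\<dots> \<le> (1 - t) * legendre b \<eta> + t * legendre b \<xi>"
      using t by (intro add_mono mult_left_mono legendre_ge) auto
    finally show "legendre b ((1 - t) *\<^sub>R \<eta> + t *\<^sub>R \<xi>) \<le> (1 - t) * legendre b \<eta> + t * legendre b \<xi>" .
  qed simp
qed simp

lemma legendre_superlinear: "\<exists>C. \<forall>\<eta>. M * \<bar>\<eta>\<bar> - C \<le> legendre b \<eta>"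
proof -
  have "M * \<bar>\<eta>\<bar> - max (b M) (b (- M)) \<le> legendre b \<eta>" for \<eta>
    using legendre_ge[of \<eta> M] legendre_ge[of \<eta> "- M"] by (cases "\<eta> \<ge> 0") (auto simp: mult.commute)
  then show ?thesis by blast
qed

lemma superlinear_legendre: "superlinear (legendre b)"
  by standard (rule continuous_legendre, rule legendre_superlinear)

text \<open>
  The modulus of \<open>exp (phase p \<eta> \<tau>)\<close> is \<open>exp (\<tau> (exponent p \<eta> + 2 b\<^sup>*(\<eta>)))\<close>. As \<open>N b \<eta> \<tau>\<close> grows like
  \<open>exp (2 \<tau> b\<^sup>*(\<eta>))\<close>, the quantity below is the exponential rate of the Szego integrand.
\<close>

definition exponent :: "(complex \<times> complex) \<times> (complex \<times> complex) \<Rightarrow> real \<Rightarrow> real" where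
  "exponent p \<eta> = \<eta> * Re (fst (fst p) + fst (snd p)) - Im (snd (fst p) + snd (snd p))
     - 2 * legendre b \<eta>"

lemma continuous_exponent: "continuous_on UNIV (exponent p)"
  unfolding exponent_def by (intro continuous_intros continuous_legendre)

text \<open>
  By duality: twice the second transform at the midpoint \<open>X\<close> is the maximum over \<open>\<eta>\<close> of
  \<open>2 \<eta> X - 2 b\<^sup>*(\<eta>)\<close>, and the remaining terms in the definition of the region add up to
  \<open>Im z\<^sub>2 + Im w\<^sub>2\<close>, so the defining inequality says that the exponent is negative at its maximum.
\<close>

lemma region_iff_exponent_neg: "p \<in> region b \<longleftrightarrow> (\<forall>\<eta>. exponent p \<eta> < 0)"
proof -
  interpret L: superlinear "legendre b" by (rule superlinear_legendre)
  obtain z1 z2 w1 w2 where p: "p = ((z1, z2), (w1, w2))" by (metis surj_pair)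
  define X where "X = (Re z1 + Re w1) / 2"
  have E: "exponent p \<eta> = 2 * (\<eta> * X - legendre b \<eta>) - Im (z2 + w2)" for \<eta>
    by (simp add: exponent_def p X_def)
  have reg: "p \<in> region b \<longleftrightarrow> 2 * legendre (legendre b) X < Im (z2 + w2)"
    by (simp add: region_def p height_def X_def)
  obtain \<eta>0 where \<eta>0: "legendre (legendre b) X = X * \<eta>0 - legendre b \<eta>0"
    using L.legendre_attained by blast
  show ?thesis
  proof
    assume "p \<in> region b"
    then show "\<forall>\<eta>. exponent p \<eta> < 0"
      using L.legendre_ge[of X] unfolding reg E by (smt (verit) mult.commute)
  next
    assume "\<forall>\<eta>. exponent p \<eta> < 0"
    then have "exponent p \<eta>0 < 0" by blast
    then show "p \<in> region b" unfolding reg E using \<eta>0 by (simp add: mult.commute)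
  qed
qed

text \<open>
  The exponent tends to \<open>-\<infinity>\<close> at least linearly in \<open>\<bar>\<eta>\<bar>\<close> because the transform is superlinear, and
  on a compact interval of \<open>\<eta>\<close> a negative continuous function stays away from \<open>0\<close>.
\<close>

lemma exponent_uniformly_neg:
  assumes "p \<in> region b"
  shows "\<exists>\<epsilon>>0. \<forall>\<eta>. exponent p \<eta> \<le> - \<epsilon> * (1 + \<bar>\<eta>\<bar>)"
proof -
  define X where "X = Re (fst (fst p) + fst (snd p))"
  define T where "T = Im (snd (fst p) + snd (snd p))"
  obtain C where C: "\<And>\<eta>. (\<bar>X\<bar> + 1) * \<bar>\<eta>\<bar> - C \<le> legendre b \<eta>"
    using legendre_superlinear by blast
  define A where "A = \<bar>2 * C - T\<bar> + 1"
  (* The growth of the transform beats the linear term \<open>\<eta> X\<close> with slope \<open>1\<close> to spare. *)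
  have far: "exponent p \<eta> \<le> A - 2 * \<bar>\<eta>\<bar>" for \<eta>
  proof -
    have "\<eta> * X \<le> \<bar>\<eta>\<bar> * \<bar>X\<bar>" using abs_ge_self[of "\<eta> * X"] by (simp add: abs_mult)
    moreover have "0 \<le> \<bar>\<eta>\<bar> * \<bar>X\<bar>" by simp
    moreover have "legendre b \<eta> \<ge> \<bar>\<eta>\<bar> * \<bar>X\<bar> + \<bar>\<eta>\<bar> - C" using C[of \<eta>] by (simp add: algebra_simps)
    ultimately show ?thesis
      unfolding exponent_def X_def[symmetric] T_def[symmetric] A_def by linarith
  qed
  have A: "A \<ge> 1" by (simp add: A_def)
  have "\<exists>y\<in>{-(A+1)..A+1}. \<forall>x\<in>{-(A+1)..A+1}. exponent p x \<le> exponent p y"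
    by (rule continuous_attains_sup)
       (use A in \<open>auto intro: continuous_on_subset[OF continuous_exponent]\<close>)
  then obtain y where "\<forall>x\<in>{-(A+1)..A+1}. exponent p x \<le> exponent p y" by blast
  then have y: "exponent p x \<le> exponent p y" if "\<bar>x\<bar> \<le> A + 1" for x
    using that by (simp add: abs_le_iff minus_le_iff)
  define \<delta> where "\<delta> = - exponent p y"
  have \<delta>: "\<delta> > 0" using assms unfolding \<delta>_def region_iff_exponent_neg by simp
  define \<epsilon> where "\<epsilon> = min (1/2) (\<delta> / (A + 2))"
  have \<epsilon>: "\<epsilon> > 0" using \<delta> A by (simp add: \<epsilon>_def)
  have \<epsilon>_half: "\<epsilon> \<le> 1/2" unfolding \<epsilon>_def by (rule min.cobounded1)
  have "\<epsilon> \<le> \<delta> / (A + 2)" unfolding \<epsilon>_def by (rule min.cobounded2)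
  then have \<epsilon>': "\<epsilon> * (A + 2) \<le> \<delta>" using A by (simp add: pos_le_divide_eq)
  have "exponent p \<eta> \<le> - \<epsilon> * (1 + \<bar>\<eta>\<bar>)" for \<eta>
  proof (cases "\<bar>\<eta>\<bar> \<le> A + 1")
    case True
    have "\<epsilon> * (1 + \<bar>\<eta>\<bar>) \<le> \<epsilon> * (A + 2)" using True \<epsilon> by (intro mult_left_mono) auto
    then show ?thesis using y[OF True] \<epsilon>' by (simp add: \<delta>_def)
  next
    case False
    have "\<epsilon> * (1 + \<bar>\<eta>\<bar>) \<le> 1/2 * (1 + \<bar>\<eta>\<bar>)" using \<epsilon>_half by (intro mult_right_mono) auto
    then show ?thesis using far[of \<eta>] False by simp
  qed
  with \<epsilon> show ?thesis by blast
qed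

text \<open>
  A perturbation of the point by \<open>v\<close> changes the rate by an amount linear in \<open>1 + \<bar>\<eta>\<bar>\<close>. This has the
  form of the gap in \<open>exponent_uniformly_neg\<close>, so a small perturbation uses up only part of that gap.
\<close>

lemma exponent_add_le:
  "exponent (p + v) \<eta> \<le> exponent p \<eta> + 2 * norm v * (1 + \<bar>\<eta>\<bar>)"
proof -
  have comp: "norm (fst (fst v)) \<le> norm v" "norm (fst (snd v)) \<le> norm v"
    "norm (snd (fst v)) \<le> norm v" "norm (snd (snd v)) \<le> norm v"
    using component_norm_le[of v] component_norm_le[of "fst v"] component_norm_le[of "snd v"]
    by linarith+
  have "\<bar>Re (fst (fst v) + fst (snd v))\<bar> \<le> 2 * norm v"
    using abs_Re_le_cmod[of "fst (fst v)"] abs_Re_le_cmod[of "fst (snd v)"] comp by simp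
  then have "\<bar>\<eta> * Re (fst (fst v) + fst (snd v))\<bar> \<le> \<bar>\<eta>\<bar> * (2 * norm v)"
    unfolding abs_mult by (intro mult_left_mono) auto
  moreover have "\<bar>Im (snd (fst v) + snd (snd v))\<bar> \<le> 2 * norm v"
    using abs_Im_le_cmod[of "snd (fst v)"] abs_Im_le_cmod[of "snd (snd v)"] comp by simp
  moreover have "exponent (p + v) \<eta> = exponent p \<eta> + \<eta> * Re (fst (fst v) + fst (snd v))
      - Im (snd (fst v) + snd (snd v))"
    by (simp add: exponent_def algebra_simps)
  ultimately show ?thesis by (simp add: algebra_simps)
qed

lemma open_region: "open (region b)"
  unfolding open_dist
proof
  fix p assume "p \<in> region b"
  then obtain \<epsilon> where \<epsilon>: "\<epsilon> > 0" "\<And>\<eta>. exponent p \<eta> \<le> - \<epsilon> * (1 + \<bar>\<eta>\<bar>)"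
    using exponent_uniformly_neg by blast
  have "q \<in> region b" if "dist q p < \<epsilon> / 2" for q
    unfolding region_iff_exponent_neg
  proof
    fix \<eta>
    have "2 * norm (q - p) * (1 + \<bar>\<eta>\<bar>) < \<epsilon> * (1 + \<bar>\<eta>\<bar>)"
      using that by (intro mult_strict_right_mono) (auto simp: dist_norm)
    then show "exponent q \<eta> < 0" using \<epsilon>(2)[of \<eta>] exponent_add_le[of p "q - p" \<eta>] by simp
  qed
  then show "\<exists>e>0. \<forall>q. dist q p < e \<longrightarrow> q \<in> region b" using \<epsilon>(1) by (intro exI[of _ "\<epsilon> / 2"]) auto
qed

lemma closure_Omega_subset: "closure (Omega b) \<subseteq> {z. b (Re (fst z)) \<le> Im (snd z)}"
proof (rule closure_minimal)
  have "continuous_on UNIV (\<lambda>z::complex \<times> complex. b (Re (fst z)))"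
    by (rule continuous_on_compose2[OF continuous]) (auto intro!: continuous_intros)
  then show "closed {z. b (Re (fst z)) \<le> Im (snd z)}"
    by (intro closed_Collect_le continuous_intros)
qed (auto simp: Omega_def)

lemma Lambda_at_iff: "y \<in> Lambda_at b \<eta> \<longleftrightarrow> legendre b \<eta> = \<eta> * y - b y"
proof -
  have "(INF x. B b \<eta> x) = - legendre b \<eta>"
  proof -
    obtain y where y: "legendre b \<eta> = \<eta> * y - b y" using legendre_attained by blast
    show ?thesis
    proof (rule cInf_eq_minimum)
      show "- legendre b \<eta> \<in> range (B b \<eta>)"
        using y by (intro image_eqI[of _ _ y]) (auto simp: B_def)
      show "- legendre b \<eta> \<le> v" if "v \<in> range (B b \<eta>)" for v
        using that legendre_ge[of \<eta>] by (auto simp: B_def algebra_simps)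
    qed
  qed
  then show ?thesis by (auto simp: Lambda_at_def B_def)
qed

text \<open>
  If the exponent is nonnegative at \<open>\<eta>\<close> for a point over the closed domain, then
  \<open>2 b\<^sup>*(\<eta>) \<le> (\<eta> x - b x) + (\<eta> r - b r)\<close>. Each bracket is at most \<open>b\<^sup>*(\<eta>)\<close>, so both are equal to it and
  \<open>x\<close> and \<open>r\<close> are global minimizers for the same slope \<open>\<eta>\<close>. Either they coincide, or the slope has
  several minimizers; these are the two pieces of the exceptional set. Finiteness is what makes
  \<^const>\<open>card\<close> detect the second case.
\<close>

lemma closure_minus_Sigma_subset_region:
  assumes fin: "\<And>\<eta>. finite (Lambda_at b \<eta>)"
  shows "closure (Omega b) \<times> closure (Omega b) - Sigma_set b \<subseteq> region b"
proof
  fix p assume p: "p \<in> closure (Omega b) \<times> closure (Omega b) - Sigma_set b"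
  obtain z w where pzw: "p = (z, w)" by (metis surj_pair)
  define x r where "x = Re (fst z)" and "r = Re (fst w)"
  have bx: "b x \<le> Im (snd z)" "b r \<le> Im (snd w)"
    using p closure_Omega_subset by (auto simp: pzw x_def r_def)
  show "p \<in> region b"
    unfolding region_iff_exponent_neg
  proof (rule allI, rule ccontr)
    fix \<eta> assume "\<not> exponent p \<eta> < 0"
    then have "2 * legendre b \<eta> \<le> (\<eta> * x - b x) + (\<eta> * r - b r)"
      using bx by (simp add: exponent_def pzw x_def r_def algebra_simps)
    then have mem: "x \<in> Lambda_at b \<eta>" "r \<in> Lambda_at b \<eta>"
      using legendre_ge[of \<eta> x] legendre_ge[of \<eta> r] by (auto simp: Lambda_at_iff)
    have "p \<in> Sigma_set b"
    proof (cases "x = r")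
      case True
      then show ?thesis using mem(1) by (auto simp: Sigma_set_def Lambda_def pzw x_def r_def)
    next
      case False
      have "card {x, r} \<le> card (Lambda_at b \<eta>)"
        using mem fin by (intro card_mono) auto
      then have "\<eta> \<in> C_set b" using False by (simp add: C_set_def)
      then show ?thesis using mem by (auto simp: Sigma_set_def pzw x_def r_def)
    qed
    then show False using p by simp
  qed
qed

text \<open>
  Superlinear growth with slope \<open>\<bar>\<eta>\<bar> + 1\<close> leaves the factor \<open>exp (- 2 \<tau> \<bar>x\<bar>)\<close>, which is compared with a
  function already known to be integrable.
\<close>

lemma N_integrable:
  assumes "\<tau> > 0"
  shows "integrable lborel (\<lambda>x. exp (2 * \<tau> * (\<eta> * x - b x)))"
proof -
  obtain C where C: "\<And>x. (\<bar>\<eta>\<bar> + 1) * \<bar>x\<bar> - C \<le> b x" using superlinear by blast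
  obtain D where D: "D \<ge> 0" "\<And>s. s \<ge> 0 \<Longrightarrow> (1 + s) ^ 2 * exp (- (2 * \<tau>) * s) \<le> D"
    using polynomial_times_exp_decay_bounded[of "2 * \<tau>" 2] assms by auto
  have le: "exp (2 * \<tau> * (\<eta> * x - b x)) \<le> exp (2 * \<tau> * C) * D * frequency_majorant x" for x
  proof -
    have "\<eta> * x \<le> \<bar>\<eta>\<bar> * \<bar>x\<bar>" using abs_ge_self[of "\<eta> * x"] by (simp add: abs_mult)
    then have "\<eta> * x - b x \<le> C - \<bar>x\<bar>" using C[of x] by (simp add: algebra_simps)
    then have "2 * \<tau> * (\<eta> * x - b x) \<le> 2 * \<tau> * (C - \<bar>x\<bar>)"
      using assms by (intro mult_left_mono) auto
    then have "exp (2 * \<tau> * (\<eta> * x - b x)) \<le> exp (2 * \<tau> * C) * exp (- (2 * \<tau>) * \<bar>x\<bar>)"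
      by (simp add: exp_add[symmetric] algebra_simps)
    also have "exp (- (2 * \<tau>) * \<bar>x\<bar>) \<le> D * frequency_majorant x"
    proof -
      have "exp (- (2 * \<tau>) * \<bar>x\<bar>) \<le> D * (1 + \<bar>x\<bar>) powr (- 2)"
        using D(2)[of "\<bar>x\<bar>"] by (simp add: powr_minus powr_numeral field_simps)
      also have "\<dots> \<le> D * frequency_majorant x"
        unfolding frequency_majorant_def using D(1) by (intro mult_left_mono powr_mono) auto
      finally show ?thesis .
    qed
    finally show ?thesis by (simp add: mult_ac)
  qed
  show ?thesis
  proof (rule Bochner_Integration.integrable_bound)
    show "integrable lborel (\<lambda>x. exp (2 * \<tau> * C) * D * frequency_majorant x)"
      using integrable_frequency_majorant by simp
    show "AE x in lborel. norm (exp (2 * \<tau> * (\<eta> * x - b x)))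
        \<le> norm (exp (2 * \<tau> * C) * D * frequency_majorant x)"
      using le D(1) by (intro AE_I2) simp
  qed measurable
qed

lemma N_measurable [measurable (raw)]:
  assumes "f \<in> borel_measurable M" and "g \<in> borel_measurable M"
  shows "(\<lambda>x. N b (f x) (g x)) \<in> borel_measurable M"
proof -
  have "(\<lambda>q. N b (fst q) (snd q)) \<in> borel_measurable (borel \<Otimes>\<^sub>M borel)"
    unfolding N_def by measurable
  from measurable_compose[OF measurable_Pair[OF assms] this] show ?thesis by simp
qed

end

section \<open>Moment integrals and differentiation under the integral sign\<close>

lemma plane_projections_measurable [measurable]:
  "fst \<in> borel_measurable (borel :: (real \<times> real) measure)"
  "snd \<in> borel_measurable (borel :: (real \<times> real) measure)"
  by (intro borel_measurable_continuous_onI continuous_intros)+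

text \<open>
  The common domination for all integrals below. The condition \<open>m < l\<close> holds for the kernel itself
  (\<open>m = 0\<close>, \<open>l = 1\<close>) and is preserved by differentiation, which either raises both exponents or
  only \<open>l\<close>.
\<close>

lemma set_integrable_of_weight_bound:
  fixes f :: "real \<times> real \<Rightarrow> 'a::{banach, second_countable_topology}"
  assumes [measurable]: "f \<in> borel_measurable borel" and "\<epsilon> > 0" and "m < l" and "C \<ge> 0"
    and bound: "\<And>\<eta> \<tau>. \<tau> > 0 \<Longrightarrow> norm (f (\<eta>, \<tau>)) \<le> C * ((1 + \<bar>\<eta>\<bar>) ^ m * \<tau> ^ l *
      exp (- \<epsilon> * (\<tau> * (1 + \<bar>\<eta>\<bar>))) * ((1 + \<tau>) * sqrt (1 + \<bar>\<eta>\<bar>)))"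
  shows "set_integrable lborel (UNIV \<times> {0<..}) f"
proof -
  obtain D where D: "D \<ge> 0" and le: "\<And>\<eta> \<tau>. \<tau> > 0 \<Longrightarrow>
    (1 + \<bar>\<eta>\<bar>) ^ m * \<tau> ^ l * exp (- \<epsilon> * (\<tau> * (1 + \<bar>\<eta>\<bar>))) * ((1 + \<tau>) * sqrt (1 + \<bar>\<eta>\<bar>))
      \<le> D * (frequency_majorant \<eta> * dilation_majorant \<tau>)"
    using weight_le_product_majorant[OF assms(2,3)] by blast
  show ?thesis
    unfolding set_integrable_def
  proof (rule Bochner_Integration.integrable_bound)
    show "integrable lborel (\<lambda>q. C * D * (case q of (\<eta>, \<tau>) \<Rightarrow> frequency_majorant \<eta> * dilation_majorant \<tau>))"
      by (intro integrable_mult_right integrable_product_majorant)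
    have [measurable]: "UNIV \<times> {0::real<..} \<in> sets (borel :: (real \<times> real) measure)"
      by (intro borel_open open_Times) auto
    show "(\<lambda>q. indicator (UNIV \<times> {0<..}) q *\<^sub>R f q) \<in> borel_measurable lborel"
      by measurable
    show "AE q in lborel. norm (indicator (UNIV \<times> {0<..}) q *\<^sub>R f q)
        \<le> norm (C * D * (case q of (\<eta>, \<tau>) \<Rightarrow> frequency_majorant \<eta> * dilation_majorant \<tau>))"
    proof (rule AE_I2)
      fix q :: "real \<times> real"
      obtain \<eta> \<tau> where q: "q = (\<eta>, \<tau>)" by (metis surj_pair)
      have "norm (f q) \<le> C * D * (frequency_majorant \<eta> * dilation_majorant \<tau>)" if "\<tau> > 0"
      proof -
        have "norm (f q) \<le> C * (D * (frequency_majorant \<eta> * dilation_majorant \<tau>))"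
          unfolding q by (rule order_trans[OF bound mult_left_mono[OF le]]) (use that assms in auto)
        then show ?thesis by (simp add: mult.assoc)
      qed
      then show "norm (indicator (UNIV \<times> {0<..}) q *\<^sub>R f q)
        \<le> norm (C * D * (case q of (\<eta>, \<tau>) \<Rightarrow> frequency_majorant \<eta> * dilation_majorant \<tau>))"
        using D \<open>C \<ge> 0\<close> by (auto simp: q indicator_def abs_mult)
    qed
  qed
qed

lemma norm_exp_remainder_le:
  fixes z :: complex
  shows "norm (exp z - 1 - z) \<le> (norm z)\<^sup>2 * exp (norm z)"
  using Taylor_exp_field[of z 1] by (simp add: power2_eq_square diff_diff_eq mult.commute)

text \<open>
  The lower bound for \<open>N\<close> behind all kernel estimates. The factor \<open>(1 + \<tau>) sqrt (1 + \<bar>\<eta>\<bar>)\<close> bounds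
  the reciprocal of the width of the peak of \<open>exp (2 \<tau> (\<eta> x - b x))\<close>; its growth in \<open>\<eta>\<close> has to be
  slower than linear for the argument of \<open>weight_le_product_majorant\<close> to work.
\<close>

locale laplace_lower_bound = superlinear b for b +
  fixes K :: real
  assumes N_lower: "\<tau> > 0 \<Longrightarrow>
    exp (2 * \<tau> * legendre b \<eta>) \<le> K * ((1 + \<tau>) * sqrt (1 + \<bar>\<eta>\<bar>)) * N b \<eta> \<tau>"
begin

lemma N_nonneg: "N b \<eta> \<tau> \<ge> 0"
  unfolding N_def by (rule Bochner_Integration.integral_nonneg) simp

lemma N_pos: "\<tau> > 0 \<Longrightarrow> N b \<eta> \<tau> > 0"
  using N_lower[of \<tau> \<eta>] N_nonneg[of \<eta> \<tau>] exp_gt_zero[of "2 * \<tau> * legendre b \<eta>"]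
  by (cases "N b \<eta> \<tau> = 0") auto

lemma K_nonneg: "K \<ge> 0"
proof (rule ccontr)
  assume "\<not> K \<ge> 0"
  then have "K * ((1 + 1) * sqrt (1 + \<bar>0\<bar>)) * N b 0 1 \<le> 0"
    using N_nonneg[of 0 1] by (intro mult_nonpos_nonneg) auto
  then show False using N_lower[of 1 0] exp_gt_zero[of "2 * 1 * legendre b 0"] by linarith
qed

text \<open>
  One family that contains the kernel and all its derivatives, closed under differentiation up to
  constants.
\<close>

definition moment_integrand ::
  "nat \<Rightarrow> nat \<Rightarrow> (complex \<times> complex) \<times> (complex \<times> complex) \<Rightarrow> real \<times> real \<Rightarrow> complex" where
  "moment_integrand m l p = (\<lambda>(\<eta>, \<tau>). exp (phase p \<eta> \<tau>) * of_real (\<eta> ^ m * \<tau> ^ l / N b \<eta> \<tau>))"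

definition moment ::
  "nat \<Rightarrow> nat \<Rightarrow> (complex \<times> complex) \<times> (complex \<times> complex) \<Rightarrow> complex" where
  "moment m l p = (LINT q : UNIV \<times> {0<..} | lborel. moment_integrand m l p q)"

lemma moment_integrand_measurable [measurable]:
  "moment_integrand m l p \<in> borel_measurable borel"
proof -
  obtain z1 z2 w1 w2 where p: "p = ((z1, z2), (w1, w2))" by (metis surj_pair)
  have "(\<lambda>q. exp (of_real (fst q * snd q) * (z1 + cnj w1) + \<i> * of_real (snd q) * (z2 - cnj w2))
      * of_real (fst q ^ m * snd q ^ l / N b (fst q) (snd q))) \<in> borel_measurable borel"
    by measurable
  then show ?thesis by (simp add: moment_integrand_def phase_def p case_prod_unfold)
qed

lemma Re_phase: "Re (phase p \<eta> \<tau>) = \<tau> * (exponent p \<eta> + 2 * legendre b \<eta>)"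
  by (cases p) (auto simp: phase_def exponent_def algebra_simps)

lemma phase_add: "phase (p + v) \<eta> \<tau> = phase p \<eta> \<tau> + phase v \<eta> \<tau>"
  by (cases p, cases v) (auto simp: phase_def algebra_simps)

lemma norm_phase_le:
  assumes "\<tau> > 0"
  shows "norm (phase v \<eta> \<tau>) \<le> 2 * norm v * (\<tau> * (1 + \<bar>\<eta>\<bar>))"
proof -
  obtain z1 z2 w1 w2 where v: "v = ((z1, z2), (w1, w2))" by (metis surj_pair)
  have comp: "norm z1 \<le> norm v" "norm z2 \<le> norm v" "norm w1 \<le> norm v" "norm w2 \<le> norm v"
    using component_norm_le[of v] component_norm_le[of "fst v"] component_norm_le[of "snd v"]
    by (auto simp: v)
  have "norm (z1 + cnj w1) \<le> 2 * norm v" "norm (z2 - cnj w2) \<le> 2 * norm v"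
    using norm_triangle_ineq[of z1 "cnj w1"] norm_triangle_ineq4[of z2 "cnj w2"] comp by auto
  then have "norm (of_real (\<eta> * \<tau>) * (z1 + cnj w1)) \<le> \<bar>\<eta>\<bar> * \<tau> * (2 * norm v)"
    "norm (\<i> * of_real \<tau> * (z2 - cnj w2)) \<le> \<tau> * (2 * norm v)"
    using assms by (auto simp: norm_mult abs_mult intro!: mult_left_mono)
  then have "norm (phase v \<eta> \<tau>) \<le> \<bar>\<eta>\<bar> * \<tau> * (2 * norm v) + \<tau> * (2 * norm v)"
    unfolding phase_def v prod.case by (rule norm_triangle_mono)
  then show ?thesis by (simp add: algebra_simps)
qed

lemma norm_exp_phase_div_N_le:
  assumes "\<tau> > 0" and "exponent p \<eta> \<le> - \<epsilon> * (1 + \<bar>\<eta>\<bar>)"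
  shows "norm (exp (phase p \<eta> \<tau>)) / N b \<eta> \<tau>
    \<le> K * (exp (- \<epsilon> * (\<tau> * (1 + \<bar>\<eta>\<bar>))) * ((1 + \<tau>) * sqrt (1 + \<bar>\<eta>\<bar>)))"
proof -
  have "\<tau> * exponent p \<eta> \<le> \<tau> * (- \<epsilon> * (1 + \<bar>\<eta>\<bar>))"
    using assms by (intro mult_left_mono) auto
  then have "exp (\<tau> * exponent p \<eta>) \<le> exp (- \<epsilon> * (\<tau> * (1 + \<bar>\<eta>\<bar>)))"
    by (simp add: mult_ac)
  moreover have "exp (2 * \<tau> * legendre b \<eta>) / N b \<eta> \<tau> \<le> K * ((1 + \<tau>) * sqrt (1 + \<bar>\<eta>\<bar>))"
    using N_lower[OF assms(1), of \<eta>] N_pos[OF assms(1), of \<eta>] by (simp add: pos_divide_le_eq)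
  ultimately have "exp (\<tau> * exponent p \<eta>) * (exp (2 * \<tau> * legendre b \<eta>) / N b \<eta> \<tau>)
      \<le> exp (- \<epsilon> * (\<tau> * (1 + \<bar>\<eta>\<bar>))) * (K * ((1 + \<tau>) * sqrt (1 + \<bar>\<eta>\<bar>)))"
    using N_nonneg by (intro mult_mono) auto
  moreover have "norm (exp (phase p \<eta> \<tau>)) = exp (\<tau> * exponent p \<eta>) * exp (2 * \<tau> * legendre b \<eta>)"
    by (simp add: norm_exp_eq_Re Re_phase exp_add[symmetric] algebra_simps)
  ultimately show ?thesis by (simp add: mult_ac)
qed

lemma norm_moment_integrand_le:
  assumes "\<tau> > 0" and "exponent p \<eta> \<le> - \<epsilon> * (1 + \<bar>\<eta>\<bar>)"
  shows "norm (moment_integrand m l p (\<eta>, \<tau>)) \<le> K * ((1 + \<bar>\<eta>\<bar>) ^ m * \<tau> ^ l *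
    exp (- \<epsilon> * (\<tau> * (1 + \<bar>\<eta>\<bar>))) * ((1 + \<tau>) * sqrt (1 + \<bar>\<eta>\<bar>)))"
proof -
  have "norm (moment_integrand m l p (\<eta>, \<tau>))
      = \<bar>\<eta>\<bar> ^ m * \<tau> ^ l * (norm (exp (phase p \<eta> \<tau>)) / N b \<eta> \<tau>)"
    using assms(1) N_nonneg
    by (simp add: moment_integrand_def norm_mult abs_mult power_abs norm_divide norm_power)
  also have "\<dots> \<le> (1 + \<bar>\<eta>\<bar>) ^ m * \<tau> ^ l *
      (K * (exp (- \<epsilon> * (\<tau> * (1 + \<bar>\<eta>\<bar>))) * ((1 + \<tau>) * sqrt (1 + \<bar>\<eta>\<bar>))))"
    using assms(1) N_nonneg
    by (intro mult_mono norm_exp_phase_div_N_le[OF assms] power_mono) auto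
  finally show ?thesis by (simp add: mult_ac)
qed

lemma set_integrable_moment_integrand:
  assumes "p \<in> region b" and "m < l"
  shows "set_integrable lborel (UNIV \<times> {0<..}) (moment_integrand m l p)"
proof -
  obtain \<epsilon> where \<epsilon>: "\<epsilon> > 0" "\<And>\<eta>. exponent p \<eta> \<le> - \<epsilon> * (1 + \<bar>\<eta>\<bar>)"
    using exponent_uniformly_neg[OF assms(1)] by blast
  show ?thesis
    by (rule set_integrable_of_weight_bound[where \<epsilon> = \<epsilon> and m = m and l = l and C = K])
       (use \<epsilon> assms(2) K_nonneg norm_moment_integrand_le in auto)
qed

text \<open>
  The phase is real-linear in the point, so \<open>phase v \<eta> \<tau>\<close> is its derivative in direction \<open>v\<close>, and the
  left-hand side is the derivative of the integrand in that direction.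
\<close>

lemma moment_integrand_times_phase:
  "moment_integrand m l p (\<eta>, \<tau>) * phase v \<eta> \<tau> =
     (fst (fst v) + cnj (fst (snd v))) * moment_integrand (m + 1) (l + 1) p (\<eta>, \<tau>) +
     \<i> * (snd (fst v) - cnj (snd (snd v))) * moment_integrand m (l + 1) p (\<eta>, \<tau>)"
proof -
  have 1: "phase v \<eta> \<tau> = of_real (\<eta> * \<tau>) * (fst (fst v) + cnj (fst (snd v)))
      + \<i> * of_real \<tau> * (snd (fst v) - cnj (snd (snd v)))"
    by (cases v) (auto simp: phase_def)
  have 2: "moment_integrand (m + 1) (l + 1) p (\<eta>, \<tau>) = of_real (\<eta> * \<tau>) * moment_integrand m l p (\<eta>, \<tau>)"
    by (simp add: moment_integrand_def)
  have 3: "moment_integrand m (l + 1) p (\<eta>, \<tau>) = of_real \<tau> * moment_integrand m l p (\<eta>, \<tau>)"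
    by (simp add: moment_integrand_def)
  show ?thesis unfolding 1 2 3 by (simp add: algebra_simps)
qed

text \<open>
  The remainder of first order is quadratic in \<open>v\<close>, with a weight that loses half of the exponential
  gap \<open>\<epsilon>\<close> and gains two powers of both \<open>\<tau>\<close> and \<open>1 + \<bar>\<eta>\<bar>\<close>. The radius \<open>\<epsilon> / 4\<close> is chosen so that
  \<open>norm (phase v \<eta> \<tau>) \<le> (\<epsilon> / 2) \<tau> (1 + \<bar>\<eta>\<bar>)\<close>.
\<close>

lemma norm_moment_integrand_remainder_le:
  assumes "\<tau> > 0" and "\<epsilon> > 0" and exponent: "exponent p \<eta> \<le> - \<epsilon> * (1 + \<bar>\<eta>\<bar>)"
    and v: "norm v \<le> \<epsilon> / 4"
  shows "norm (moment_integrand m l (p + v) (\<eta>, \<tau>) - moment_integrand m l p (\<eta>, \<tau>)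
      - moment_integrand m l p (\<eta>, \<tau>) * phase v \<eta> \<tau>)
    \<le> (norm v)\<^sup>2 * (4 * K * ((1 + \<bar>\<eta>\<bar>) ^ (m + 2) * \<tau> ^ (l + 2) *
        exp (- (\<epsilon> / 2) * (\<tau> * (1 + \<bar>\<eta>\<bar>))) * ((1 + \<tau>) * sqrt (1 + \<bar>\<eta>\<bar>))))"
proof -
  define s where "s = \<tau> * (1 + \<bar>\<eta>\<bar>)"
  define u where "u = phase v \<eta> \<tau>"
  define A where "A = (1 + \<bar>\<eta>\<bar>) ^ m * \<tau> ^ l * ((1 + \<tau>) * sqrt (1 + \<bar>\<eta>\<bar>))"
  have s: "s > 0" using assms(1) by (simp add: s_def)
  have A: "A \<ge> 0" using assms(1) by (simp add: A_def)
  have u: "norm u \<le> 2 * norm v * s"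
    using norm_phase_le[OF assms(1)] by (simp add: u_def s_def)
  also have "\<dots> \<le> (\<epsilon> / 2) * s" using v s by (intro mult_right_mono) auto
  finally have u': "norm u \<le> (\<epsilon> / 2) * s" .
  have "moment_integrand m l (p + v) (\<eta>, \<tau>) = moment_integrand m l p (\<eta>, \<tau>) * exp u"
    by (simp add: moment_integrand_def phase_add exp_add u_def)
  then have "norm (moment_integrand m l (p + v) (\<eta>, \<tau>) - moment_integrand m l p (\<eta>, \<tau>)
      - moment_integrand m l p (\<eta>, \<tau>) * phase v \<eta> \<tau>)
    = norm (moment_integrand m l p (\<eta>, \<tau>)) * norm (exp u - 1 - u)"
    by (simp add: u_def[symmetric] norm_mult[symmetric] right_diff_distrib)
  also have "\<dots> \<le> K * (A * exp (- \<epsilon> * s)) * ((2 * norm v * s)\<^sup>2 * exp ((\<epsilon> / 2) * s))"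
  proof (rule mult_mono)
    show "norm (moment_integrand m l p (\<eta>, \<tau>)) \<le> K * (A * exp (- \<epsilon> * s))"
      using norm_moment_integrand_le[OF assms(1) exponent, of m l] by (simp add: A_def s_def mult_ac)
    show "norm (exp u - 1 - u) \<le> (2 * norm v * s)\<^sup>2 * exp ((\<epsilon> / 2) * s)"
      using u u' by (intro order_trans[OF norm_exp_remainder_le] mult_mono power_mono) auto
  qed (use A K_nonneg in auto)
  also have "\<dots> = (norm v)\<^sup>2 * (4 * K * (s\<^sup>2 * A * (exp (- \<epsilon> * s) * exp ((\<epsilon> / 2) * s))))"
    by (simp add: power_mult_distrib mult_ac)
  also have "exp (- \<epsilon> * s) * exp ((\<epsilon> / 2) * s) = exp (- (\<epsilon> / 2) * s)"
    by (simp add: exp_add[symmetric])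
  also have "s\<^sup>2 * A * exp (- (\<epsilon> / 2) * s) = (1 + \<bar>\<eta>\<bar>) ^ (m + 2) * \<tau> ^ (l + 2) *
        exp (- (\<epsilon> / 2) * (\<tau> * (1 + \<bar>\<eta>\<bar>))) * ((1 + \<tau>) * sqrt (1 + \<bar>\<eta>\<bar>))"
    by (simp only: s_def A_def power_add power_mult_distrib mult_ac)
  finally show ?thesis .
qed

text \<open>
  Differentiation under the integral sign: integrating the quadratic remainder bound gives
  \<open>O((norm v)\<^sup>2)\<close> for the remainder of the integral, so no limit has to be exchanged.
\<close>

lemma moment_has_derivative:
  assumes p: "p \<in> region b" and "m < l"
  shows "(moment m l has_derivative (\<lambda>v.
      (fst (fst v) + cnj (fst (snd v))) * moment (m + 1) (l + 1) p +
      \<i> * (snd (fst v) - cnj (snd (snd v))) * moment m (l + 1) p)) (at p)"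
    (is "(_ has_derivative ?D) _")
proof -
  let ?A = "UNIV \<times> {0<..} :: (real \<times> real) set"
  have [measurable]: "?A \<in> sets borel" by (intro borel_open open_Times) auto
  obtain \<epsilon> where \<epsilon>: "\<epsilon> > 0" "\<And>\<eta>. exponent p \<eta> \<le> - \<epsilon> * (1 + \<bar>\<eta>\<bar>)"
    using exponent_uniformly_neg[OF p] by blast
  define G :: "real \<times> real \<Rightarrow> real" where "G = (\<lambda>(\<eta>, \<tau>). 4 * K * ((1 + \<bar>\<eta>\<bar>) ^ (m + 2) * \<tau> ^ (l + 2) *
        exp (- (\<epsilon> / 2) * (\<tau> * (1 + \<bar>\<eta>\<bar>))) * ((1 + \<tau>) * sqrt (1 + \<bar>\<eta>\<bar>))))"
  have G_meas [measurable]: "G \<in> borel_measurable borel"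
    unfolding G_def case_prod_unfold by measurable
  have G: "set_integrable lborel ?A G"
  proof (rule set_integrable_of_weight_bound[where \<epsilon> = "\<epsilon> / 2" and m = "m + 2" and l = "l + 2"
        and C = "4 * K"])
    fix \<eta> \<tau> :: real assume "\<tau> > 0"
    then have "G (\<eta>, \<tau>) \<ge> 0" using K_nonneg by (simp add: G_def)
    then show "norm (G (\<eta>, \<tau>)) \<le> 4 * K * ((1 + \<bar>\<eta>\<bar>) ^ (m + 2) * \<tau> ^ (l + 2) *
        exp (- (\<epsilon> / 2) * (\<tau> * (1 + \<bar>\<eta>\<bar>))) * ((1 + \<tau>) * sqrt (1 + \<bar>\<eta>\<bar>)))"
      by (simp add: G_def)
  qed (use \<epsilon>(1) assms(2) K_nonneg G_meas in auto)
  define D where "D = (LINT q:?A|lborel. G q)"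
  show ?thesis
  proof (rule has_derivativeI_sandwich[where e = "\<epsilon> / 4" and H = "\<lambda>y. norm (y - p) * D"])
    show "\<epsilon> / 4 > 0" using \<epsilon> by simp
    have 1: "bounded_linear (\<lambda>v :: (complex \<times> complex) \<times> (complex \<times> complex).
        fst (fst v) + cnj (fst (snd v)))"
      by (intro bounded_linear_add bounded_linear_compose[OF bounded_linear_cnj]
          bounded_linear_compose[OF bounded_linear_fst] bounded_linear_fst bounded_linear_snd)
    have 2: "bounded_linear (\<lambda>v :: (complex \<times> complex) \<times> (complex \<times> complex).
        snd (fst v) - cnj (snd (snd v)))"
      by (intro bounded_linear_sub bounded_linear_compose[OF bounded_linear_cnj]
          bounded_linear_compose[OF bounded_linear_snd] bounded_linear_fst bounded_linear_snd)
    show "bounded_linear ?D"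
      by (rule bounded_linear_add[OF bounded_linear_mult_const[OF 1]
            bounded_linear_mult_const[OF bounded_linear_const_mult[OF 2]]])
    show "((\<lambda>y. norm (y - p) * D) \<longlongrightarrow> 0) (at p)"
      by (rule tendsto_eq_intros refl | simp)+
    show "norm (moment m l y - moment m l p - ?D (y - p)) / norm (y - p) \<le> norm (y - p) * D"
      if y: "y \<noteq> p" "dist y p < \<epsilon> / 4" for y
    proof -
      define v where "v = y - p"
      have v: "y = p + v" "v \<noteq> 0" "norm v \<le> \<epsilon> / 4" using y by (auto simp: v_def dist_norm)
      have y_region: "y \<in> region b"
        unfolding region_iff_exponent_neg
      proof
        fix \<eta>
        have "2 * norm v * (1 + \<bar>\<eta>\<bar>) < \<epsilon> * (1 + \<bar>\<eta>\<bar>)"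
          using v \<epsilon>(1) by (intro mult_strict_right_mono) auto
        then show "exponent y \<eta> < 0" using \<epsilon>(2)[of \<eta>] exponent_add_le[of p v \<eta>] by (simp add: v)
      qed
      define R where "R = (\<lambda>q. moment_integrand m l y q - moment_integrand m l p q
        - ((fst (fst v) + cnj (fst (snd v))) * moment_integrand (m + 1) (l + 1) p q +
           \<i> * (snd (fst v) - cnj (snd (snd v))) * moment_integrand m (l + 1) p q))"
      have ints: "set_integrable lborel ?A (moment_integrand m l y)"
        "set_integrable lborel ?A (moment_integrand m l p)"
        "set_integrable lborel ?A (moment_integrand (m + 1) (l + 1) p)"
        "set_integrable lborel ?A (moment_integrand m (l + 1) p)"
        using assms y_region by (auto intro: set_integrable_moment_integrand)
      have R_int: "set_integrable lborel ?A R"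
        unfolding R_def by (intro set_integral_diff set_integral_add set_integrable_mult_right ints)
      have "moment m l y - moment m l p - ?D v = (LINT q:?A|lborel. R q)"
        unfolding R_def moment_def using ints
        by (simp add: set_integral_diff set_integral_add)
      also have "norm \<dots> \<le> (LINT q:?A|lborel. norm (R q))"
        using R_int by (rule set_integral_norm_bound)
      also have "\<dots> \<le> (LINT q:?A|lborel. (norm v)\<^sup>2 * G q)"
      proof (rule set_integral_mono)
        show "set_integrable lborel ?A (\<lambda>q. norm (R q))" using R_int by (rule set_integrable_norm)
        show "set_integrable lborel ?A (\<lambda>q. (norm v)\<^sup>2 * G q)" using G by simp
        show "norm (R q) \<le> (norm v)\<^sup>2 * G q" if q_in: "q \<in> ?A" for q
        proof -
          obtain \<eta> \<tau> where q: "q = (\<eta>, \<tau>)" "\<tau> > 0" using q_in by (cases q) auto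
          show ?thesis
            using norm_moment_integrand_remainder_le[OF q(2) \<epsilon>(1) \<epsilon>(2)[of \<eta>] v(3), of m l]
            unfolding R_def q(1) v(1) G_def moment_integrand_times_phase prod.case .
        qed
      qed
      also have "\<dots> = (norm v)\<^sup>2 * D" by (simp add: D_def)
      finally show ?thesis
        using v(2) by (simp add: v_def[symmetric] power2_eq_square pos_divide_le_eq mult_ac)
    qed
  qed
qed

end

section \<open>Iterated Wirtinger derivatives\<close>

lemma real_partial_eq:
  assumes "(f has_derivative f') (at p)"
  shows "real_partial v f p = f' v"
proof -
  have "((\<lambda>s. p + s *\<^sub>R v) has_derivative (\<lambda>s. s *\<^sub>R v)) (at 0)"
    by (auto intro!: derivative_eq_intros)
  then have "((\<lambda>s. f (p + s *\<^sub>R v)) has_derivative (\<lambda>s. f' (s *\<^sub>R v))) (at 0)"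
    by (rule has_derivative_compose) (simp add: assms)
  then have "((\<lambda>s. f (p + s *\<^sub>R v)) has_vector_derivative f' v) (at 0)"
    using linear_cmul[OF has_derivative_linear[OF assms]] by (simp add: has_vector_derivative_def)
  then show ?thesis unfolding real_partial_def by (rule vector_derivative_at)
qed

text \<open>
  Partial derivatives depend only on the germ of the function. This is needed because the iterated
  derivatives are identified with moments on the region only, not globally.
\<close>

lemma real_partial_cong:
  assumes "open S" and "p \<in> S" and eq: "\<And>q. q \<in> S \<Longrightarrow> f q = g q"
  shows "real_partial v f p = real_partial v g p"
proof -
  have "((\<lambda>s. p + s *\<^sub>R v) \<longlongrightarrow> p + 0 *\<^sub>R v) (nhds 0)"
    by (intro tendsto_intros filterlim_ident)
  then have "eventually (\<lambda>s. p + s *\<^sub>R v \<in> S) (nhds 0)"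
    using assms(1,2) by (auto dest: topological_tendstoD)
  then have "eventually (\<lambda>s. f (p + s *\<^sub>R v) = g (p + s *\<^sub>R v)) (nhds 0)"
    by eventually_elim (rule eq)
  then show ?thesis
    unfolding real_partial_def by (intro vector_derivative_cong_eq) auto
qed

lemma wirtinger_cong:
  assumes "open S" and "p \<in> S" and "\<And>q. q \<in> S \<Longrightarrow> f q = g q"
  shows "wirtinger e f p = wirtinger e g p" and "wirtinger_bar e f p = wirtinger_bar e g p"
  unfolding wirtinger_def wirtinger_bar_def using real_partial_cong[OF assms] by simp_all

text \<open>
  If \<open>D\<close> depends only on values on \<open>S\<close>, a sequence \<open>F\<close> of candidates for the iterates needs to
  satisfy the recursion on \<open>S\<close> only.
\<close>

lemma iterate_local_operator:
  assumes cong: "\<And>f g p. p \<in> S \<Longrightarrow> (\<And>q. q \<in> S \<Longrightarrow> f q = g q) \<Longrightarrow> D f p = D g p"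
    and step: "\<And>k p. p \<in> S \<Longrightarrow> D (F k) p = F (Suc k) p"
    and base: "\<And>p. p \<in> S \<Longrightarrow> f p = F 0 p" and "p \<in> S"
  shows "(D ^^ k) f p = F k p"
  using \<open>p \<in> S\<close>
proof (induction k arbitrary: p)
  case 0
  then show ?case by (simp add: base)
next
  case (Suc k)
  have "(D ^^ Suc k) f p = D (F k) p"
    unfolding funpow.simps comp_def using Suc by (intro cong)
  then show ?case using step Suc.prems by simp
qed

context laplace_lower_bound
begin

text \<open>
  The kernel is holomorphic in \<open>z\<close> and antiholomorphic in \<open>w\<close>, so each of these four operators
  differentiates the phase: in \<open>z\<^sub>1\<close> and \<open>\<bar>w\<^sub>1\<close> it brings down \<open>\<eta> \<tau>\<close>, in \<open>z\<^sub>2\<close> the factor \<open>\<i> \<tau>\<close>, and in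
  \<open>\<bar>w\<^sub>2\<close> the factor \<open>- \<i> \<tau>\<close>.
\<close>

lemma wirtinger_moment:
  assumes p: "p \<in> region b" and "m < l"
  shows "wirtinger (\<lambda>\<zeta>. ((\<zeta>, 0), (0, 0))) (\<lambda>p. a * moment m l p) p = a * moment (Suc m) (Suc l) p"
    and "wirtinger_bar (\<lambda>\<zeta>. ((0, 0), (\<zeta>, 0))) (\<lambda>p. a * moment m l p) p = a * moment (Suc m) (Suc l) p"
    and "wirtinger (\<lambda>\<zeta>. ((0, \<zeta>), (0, 0))) (\<lambda>p. a * moment m l p) p = \<i> * a * moment m (Suc l) p"
    and "wirtinger_bar (\<lambda>\<zeta>. ((0, 0), (0, \<zeta>))) (\<lambda>p. a * moment m l p) p = - \<i> * a * moment m (Suc l) p"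
proof -
  note D = real_partial_eq[OF has_derivative_mult_right[OF moment_has_derivative[OF assms], of a]]
  show "wirtinger (\<lambda>\<zeta>. ((\<zeta>, 0), (0, 0))) (\<lambda>p. a * moment m l p) p = a * moment (Suc m) (Suc l) p"
    "wirtinger_bar (\<lambda>\<zeta>. ((0, 0), (\<zeta>, 0))) (\<lambda>p. a * moment m l p) p = a * moment (Suc m) (Suc l) p"
    "wirtinger (\<lambda>\<zeta>. ((0, \<zeta>), (0, 0))) (\<lambda>p. a * moment m l p) p = \<i> * a * moment m (Suc l) p"
    "wirtinger_bar (\<lambda>\<zeta>. ((0, 0), (0, \<zeta>))) (\<lambda>p. a * moment m l p) p = - \<i> * a * moment m (Suc l) p"
    unfolding wirtinger_def wirtinger_bar_def D by (simp_all add: algebra_simps)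
qed

lemma mixed_deriv_moment:
  assumes "p \<in> region b" and "m < l"
  shows "mixed_deriv i1 j1 i2 j2 (\<lambda>p. a * moment m l p) p =
    \<i> ^ i2 * (- \<i>) ^ j2 * a * moment (m + i1 + j1) (l + i1 + j1 + i2 + j2) p"
proof -
  note cong = wirtinger_cong[OF open_region]
  let ?W1 = "wirtinger (\<lambda>\<zeta>. ((\<zeta>, 0), (0, 0)))" and ?W2 = "wirtinger_bar (\<lambda>\<zeta>. ((0, 0), (\<zeta>, 0)))"
  let ?W3 = "wirtinger (\<lambda>\<zeta>. ((0, \<zeta>), (0, 0)))" and ?W4 = "wirtinger_bar (\<lambda>\<zeta>. ((0, 0), (0, \<zeta>)))"
  let ?c = "\<i> ^ i2 * ((- \<i>) ^ j2 * a)"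
  have 1: "(?W4 ^^ j2) (\<lambda>p. a * moment m l p) p = (- \<i>) ^ j2 * a * moment m (l + j2) p"
    if "p \<in> region b" for p
  proof (rule iterate_local_operator[where S = "region b"
        and F = "\<lambda>k p. (- \<i>) ^ k * a * moment m (l + k) p"])
    fix k p assume "p \<in> region b"
    from wirtinger_moment(4)[OF this, of m "l + k" "(- \<i>) ^ k * a"] assms(2)
    show "?W4 (\<lambda>p. (- \<i>) ^ k * a * moment m (l + k) p) p = (- \<i>) ^ Suc k * a * moment m (l + Suc k) p"
      by simp
  qed (simp_all add: that, rule cong)
  have 2: "(?W3 ^^ i2) ((?W4 ^^ j2) (\<lambda>p. a * moment m l p)) p = ?c * moment m (l + j2 + i2) p"
    if "p \<in> region b" for p
  proof (rule iterate_local_operator[where S = "region b"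
        and F = "\<lambda>k p. \<i> ^ k * ((- \<i>) ^ j2 * a) * moment m (l + j2 + k) p"])
    fix k p assume "p \<in> region b"
    from wirtinger_moment(3)[OF this, of m "l + j2 + k" "\<i> ^ k * ((- \<i>) ^ j2 * a)"] assms(2)
    show "?W3 (\<lambda>p. \<i> ^ k * ((- \<i>) ^ j2 * a) * moment m (l + j2 + k) p) p
        = \<i> ^ Suc k * ((- \<i>) ^ j2 * a) * moment m (l + j2 + Suc k) p"
      by simp
  qed (simp_all add: that 1, rule cong)
  have 3: "(?W2 ^^ j1) ((?W3 ^^ i2) ((?W4 ^^ j2) (\<lambda>p. a * moment m l p))) p
      = ?c * moment (m + j1) (l + j2 + i2 + j1) p" if "p \<in> region b" for p
  proof (rule iterate_local_operator[where S = "region b"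
        and F = "\<lambda>k p. ?c * moment (m + k) (l + j2 + i2 + k) p"])
    fix k p assume "p \<in> region b"
    from wirtinger_moment(2)[OF this, of "m + k" "l + j2 + i2 + k" ?c] assms(2)
    show "?W2 (\<lambda>p. ?c * moment (m + k) (l + j2 + i2 + k) p) p
        = ?c * moment (m + Suc k) (l + j2 + i2 + Suc k) p"
      by simp
  qed (simp_all add: that 2, rule cong)
  have "mixed_deriv i1 j1 i2 j2 (\<lambda>p. a * moment m l p) p
      = ?c * moment (m + j1 + i1) (l + j2 + i2 + j1 + i1) p"
    unfolding mixed_deriv_def
  proof (rule iterate_local_operator[where S = "region b"
        and F = "\<lambda>k p. ?c * moment (m + j1 + k) (l + j2 + i2 + j1 + k) p"])
    fix k p assume "p \<in> region b"
    from wirtinger_moment(1)[OF this, of "m + j1 + k" "l + j2 + i2 + j1 + k" ?c] assms(2)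
    show "?W1 (\<lambda>p. ?c * moment (m + j1 + k) (l + j2 + i2 + j1 + k) p) p
        = ?c * moment (m + j1 + Suc k) (l + j2 + i2 + j1 + Suc k) p"
      by simp
  qed (simp_all add: assms 3, rule cong)
  then show ?thesis by (simp add: ac_simps)
qed

lemma szego_deriv_integrand_eq_moment_integrand:
  "szego_deriv_integrand b i1 j1 i2 j2 = moment_integrand (i1 + j1) (i1 + j1 + i2 + j2 + 1)"
  by (simp add: fun_eq_iff szego_deriv_integrand_def moment_integrand_def)

lemma szego_integrand_eq_moment_integrand: "szego_integrand b = moment_integrand 0 1"
  by (simp add: fun_eq_iff szego_integrand_def moment_integrand_def field_simps)

lemma mixed_deriv_szego:
  assumes "p \<in> region b"
  shows "mixed_deriv i1 j1 i2 j2 (szego c b) p =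
    \<i> ^ i2 * (- \<i>) ^ j2 * c * moment (i1 + j1) (i1 + j1 + i2 + j2 + 1) p"
proof -
  have "szego c b = (\<lambda>p. c * moment 0 1 p)"
    by (simp add: fun_eq_iff szego_def szego_integrand_eq_moment_integrand moment_def)
  then show ?thesis using mixed_deriv_moment[OF assms, of 0 1] by simp
qed

lemma mixed_deriv_szego_differentiable:
  assumes "p \<in> region b"
  shows "mixed_deriv i1 j1 i2 j2 (szego c b) differentiable (at p)"
proof -
  let ?a = "\<i> ^ i2 * (- \<i>) ^ j2 * c" and ?m = "moment (i1 + j1) (i1 + j1 + i2 + j2 + 1)"
  have "i1 + j1 < i1 + j1 + i2 + j2 + 1" by simp
  from has_derivative_mult_right[OF moment_has_derivative[OF assms this], of ?a]
  obtain f' where "((\<lambda>p. ?a * ?m p) has_derivative f') (at p)" by blast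
  then have "(mixed_deriv i1 j1 i2 j2 (szego c b) has_derivative f') (at p)"
    by (rule has_derivative_transform_within_open[OF _ open_region assms])
       (simp add: mixed_deriv_szego)
  then show ?thesis by (rule differentiableI)
qed

end

section \<open>Laplace integrals of polynomials of even degree\<close>

lemma poly_growth_le:
  fixes q :: "real poly"
  assumes "degree q \<le> d"
  shows "\<exists>A\<ge>0. \<forall>x. \<bar>poly q x\<bar> \<le> A * (1 + \<bar>x\<bar>) ^ d"
proof (intro exI[of _ "\<Sum>i\<le>degree q. \<bar>coeff q i\<bar>"] conjI allI)
  fix x :: real
  have "\<bar>poly q x\<bar> \<le> (\<Sum>i\<le>degree q. \<bar>coeff q i * x ^ i\<bar>)"
    unfolding poly_altdef by (rule sum_abs)
  also have "\<dots> \<le> (\<Sum>i\<le>degree q. \<bar>coeff q i\<bar> * (1 + \<bar>x\<bar>) ^ d)"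
  proof (rule sum_mono)
    fix i assume i: "i \<in> {..degree q}"
    have "\<bar>x\<bar> ^ i \<le> (1 + \<bar>x\<bar>) ^ i" by (intro power_mono) auto
    also have "\<dots> \<le> (1 + \<bar>x\<bar>) ^ d" using i assms by (intro power_increasing) auto
    finally show "\<bar>coeff q i * x ^ i\<bar> \<le> \<bar>coeff q i\<bar> * (1 + \<bar>x\<bar>) ^ d"
      by (simp add: abs_mult power_abs mult_left_mono)
  qed
  finally show "\<bar>poly q x\<bar> \<le> (\<Sum>i\<le>degree q. \<bar>coeff q i\<bar>) * (1 + \<bar>x\<bar>) ^ d"
    by (simp add: sum_distrib_right)
qed (simp add: sum_nonneg)

text \<open>
  A lower bound for \<open>\<bar>x\<bar>\<close> powers in terms of \<open>1 + \<bar>x\<bar>\<close>, which compares a leading term directly with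
  bounds of the form \<open>poly_growth_le\<close> for the lower-order terms.
\<close>

lemma power_abs_ge:
  fixes x :: real
  shows "(1 + \<bar>x\<bar>) ^ m * (1 + \<bar>x\<bar> - real (Suc m)) \<le> \<bar>x\<bar> ^ Suc m"
proof (induction m)
  case (Suc m)
  let ?L = "1 + \<bar>x\<bar>"
  have "?L ^ Suc m * (?L - real (Suc (Suc m))) \<le> ?L ^ m * (\<bar>x\<bar> * (?L - real (Suc m)))"
    unfolding power_Suc2 mult.assoc by (intro mult_left_mono) (auto simp: algebra_simps)
  also have "\<dots> \<le> \<bar>x\<bar> * \<bar>x\<bar> ^ Suc m"
    using mult_left_mono[OF Suc.IH, of "\<bar>x\<bar>"] by (simp only: mult_ac abs_ge_zero simp_thms)
  finally show ?case by simp
qed simp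

text \<open>
  Splitting off the leading term leaves a remainder about which only the degree matters.
\<close>

locale even_degree_polynomial =
  fixes n :: nat and Q :: "real poly" and b :: "real \<Rightarrow> real"
  assumes n_pos: "n \<ge> 1" and degree_Q: "degree Q < 2 * n"
    and b_eq: "b = (\<lambda>x. x ^ (2 * n) / (2 * real n) + poly Q x)"
begin

definition P :: "real poly" where "P = monom (1 / (2 * real n)) (2 * n) + Q"

lemma b_eq_poly: "b = poly P"
  by (auto simp: b_eq P_def poly_monom)

lemma poly_pderiv_P: "poly (pderiv P) x = x ^ (2 * n - 1) + poly (pderiv Q) x"
  using n_pos by (simp add: P_def pderiv_add pderiv_monom poly_monom)

lemma superlinear_b: "superlinear b"
proof
  show "continuous_on UNIV b" unfolding b_eq_poly by (intro continuous_intros)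
  fix M :: real
  have "degree Q \<le> 2 * n - 1" using degree_Q by simp
  then obtain A where A: "A \<ge> 0" "\<And>x. \<bar>poly Q x\<bar> \<le> A * (1 + \<bar>x\<bar>) ^ (2 * n - 1)"
    using poly_growth_le by blast
  (* Beyond \<open>R\<close> the leading term exceeds the lower-order terms by at least \<open>\<bar>M\<bar> (1 + \<bar>x\<bar>)\<close>. *)
  define R where "R = 2 * real n * (1 + A + \<bar>M\<bar>)"
  have R: "R \<ge> 0" using A by (simp add: R_def)
  have "M * \<bar>x\<bar> - (\<bar>M\<bar> * R + R ^ (2 * n - 1) * (1 + A)) \<le> b x" for x
  proof -
    define L where "L = 1 + \<bar>x\<bar>"
    have L: "L \<ge> 1" "\<bar>x\<bar> \<le> L" by (auto simp: L_def)
    have "L ^ (2 * n - 1) * (L - 2 * real n) \<le> x ^ (2 * n)"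
      using power_abs_ge[of x "2 * n - 1"] n_pos by (simp add: L_def power_even_abs)
    then have "L ^ (2 * n - 1) * (L - 2 * real n) / (2 * real n) \<le> x ^ (2 * n) / (2 * real n)"
      by (intro divide_right_mono) auto
    then have "L ^ (2 * n - 1) * (L / (2 * real n) - 1) \<le> x ^ (2 * n) / (2 * real n)"
      using n_pos by (simp add: field_simps)
    then have lower: "L ^ (2 * n - 1) * (L / (2 * real n) - 1 - A) \<le> b x"
      using A(2)[of x] by (simp add: b_eq L_def[symmetric] algebra_simps)
    have M: "M * \<bar>x\<bar> \<le> \<bar>M\<bar> * L" using L by (intro mult_mono) auto
    show ?thesis
    proof (cases "L \<ge> R")
      case True
      then have "L / (2 * real n) - 1 - A \<ge> \<bar>M\<bar>"
        using n_pos by (simp add: R_def field_simps)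
      moreover have "L ^ 1 \<le> L ^ (2 * n - 1)" using L n_pos by (intro power_increasing) auto
      ultimately have "L * \<bar>M\<bar> \<le> L ^ (2 * n - 1) * (L / (2 * real n) - 1 - A)"
        using L by (intro mult_mono) auto
      moreover have "0 \<le> \<bar>M\<bar> * R + R ^ (2 * n - 1) * (1 + A)" using R A by simp
      ultimately show ?thesis using M lower by (simp add: mult.commute)
    next
      case False
      have "L ^ (2 * n - 1) * (- (1 + A)) \<le> L ^ (2 * n - 1) * (L / (2 * real n) - 1 - A)"
        using L by (intro mult_left_mono) auto
      moreover have "L ^ (2 * n - 1) * (1 + A) \<le> R ^ (2 * n - 1) * (1 + A)"
        using L A False by (intro mult_right_mono power_mono) auto
      moreover have "\<bar>M\<bar> * L \<le> \<bar>M\<bar> * R" using False by (intro mult_left_mono) auto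
      ultimately show ?thesis using M lower unfolding mult_minus_right by linarith
    qed
  qed
  then show "\<exists>C. \<forall>x. M * \<bar>x\<bar> - C \<le> b x" by blast
qed

sublocale superlinear b by (rule superlinear_b)

lemma pderiv_eq_at_maximizer:
  assumes "legendre b \<eta> = \<eta> * y - b y"
  shows "poly (pderiv P) y = \<eta>"
proof -
  have "DERIV (\<lambda>x. \<eta> * x - b x) y :> \<eta> - poly (pderiv P) y"
    unfolding b_eq_poly by (auto intro!: derivative_eq_intros poly_DERIV)
  from DERIV_local_max[OF this zero_less_one] have "\<eta> - poly (pderiv P) y = 0"
    using legendre_ge[of \<eta>] assms by auto
  then show ?thesis by simp
qed

text \<open>
  Minimizers are roots of \<open>b' - \<eta>\<close>, a polynomial of degree \<open>2 n - 1 \<ge> 1\<close>.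
\<close>

lemma finite_Lambda_at: "finite (Lambda_at b \<eta>)"
proof (rule finite_subset)
  show "Lambda_at b \<eta> \<subseteq> {y. poly (pderiv P - [:\<eta>:]) y = 0}"
    using pderiv_eq_at_maximizer by (auto simp: Lambda_at_iff)
  obtain d where d: "2 * n = Suc (Suc d)"
    using n_pos by (cases n) auto
  have "coeff (pderiv P - [:\<eta>:]) (Suc d) = 1"
    using n_pos degree_Q d[symmetric]
    by (simp add: P_def coeff_pderiv coeff_eq_0 flip: of_nat_Suc)
  then have "pderiv P - [:\<eta>:] \<noteq> 0" by force
  then show "finite {y. poly (pderiv P - [:\<eta>:]) y = 0}"
    by (rule poly_roots_finite)
qed

text \<open>
  The maximizer satisfies \<open>b'(y) = \<eta>\<close>, where \<open>b'\<close> has degree \<open>2 n - 1\<close>. So \<open>\<bar>y\<bar> ^ (2 n - 1)\<close> is of order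
  at most \<open>1 + \<bar>\<eta>\<bar>\<close>, and the exponent \<open>2 n - 2\<close>, that of the second derivative of \<open>b\<close>, follows with
  room to spare.
\<close>

lemma maximizer_growth:
  "\<exists>C\<ge>0. \<forall>\<eta> y. legendre b \<eta> = \<eta> * y - b y \<longrightarrow> (1 + \<bar>y\<bar>) ^ (2 * n - 2) \<le> C * (1 + \<bar>\<eta>\<bar>)"
proof -
  have "degree (pderiv Q) \<le> 2 * n - 2" using degree_Q by (simp add: degree_pderiv)
  then obtain A where A: "A \<ge> 0" "\<And>x. \<bar>poly (pderiv Q) x\<bar> \<le> A * (1 + \<bar>x\<bar>) ^ (2 * n - 2)"
    using poly_growth_le by blast
  define C where "C = 1 + (2 * real n + A) ^ (2 * n - 2)"
  have C: "C \<ge> 1" using A by (simp add: C_def)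
  have "(1 + \<bar>y\<bar>) ^ (2 * n - 2) \<le> C * (1 + \<bar>\<eta>\<bar>)" if y: "legendre b \<eta> = \<eta> * y - b y" for \<eta> y
  proof -
    define L where "L = 1 + \<bar>y\<bar>"
    have L: "L \<ge> 1" by (simp add: L_def)
    have le_C: "L ^ (2 * n - 2) \<le> C \<or> L ^ (2 * n - 2) \<le> \<bar>\<eta>\<bar>"
    proof (cases "L \<ge> 2 * real n + A")
      case True
      have Suc: "2 * n - 1 = Suc (2 * n - 2)" using n_pos by simp
      have "L ^ (2 * n - 2) * 1 \<le> L ^ (2 * n - 2) * (L - real (2 * n - 1) - A)"
        using L True n_pos by (intro mult_left_mono) (auto simp: of_nat_diff)
      also have "\<dots> = L ^ (2 * n - 2) * (L - real (2 * n - 1)) - A * L ^ (2 * n - 2)"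
        by (simp add: algebra_simps)
      also have "\<dots> \<le> \<bar>y\<bar> ^ (2 * n - 1) - \<bar>poly (pderiv Q) y\<bar>"
        using power_abs_ge[of y "2 * n - 2"] A(2)[of y]
        unfolding Suc[symmetric] L_def[symmetric] by simp
      also have "\<dots> \<le> \<bar>poly (pderiv P) y\<bar>"
        unfolding poly_pderiv_P power_abs[symmetric] by simp
      finally show ?thesis using pderiv_eq_at_maximizer[OF y] by simp
    next
      case False
      then have "L ^ (2 * n - 2) \<le> (2 * real n + A) ^ (2 * n - 2)"
        using L by (intro power_mono) auto
      then show ?thesis by (simp add: C_def)
    qed
    have "C * 1 \<le> C * (1 + \<bar>\<eta>\<bar>)" "1 * \<bar>\<eta>\<bar> \<le> C * (1 + \<bar>\<eta>\<bar>)"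
      using C by (intro mult_mono; simp)+
    then show ?thesis using le_C unfolding L_def by linarith
  qed
  moreover have "C \<ge> 0" using C by simp
  ultimately show ?thesis by blast
qed

text \<open>
  Two applications of the mean value theorem. They evaluate the second derivative at a point \<open>\<zeta>\<close>
  within distance \<open>1\<close> of \<open>y\<close>, where \<open>1 + \<bar>\<zeta>\<bar> \<le> 2 (1 + \<bar>y\<bar>)\<close>.
\<close>

lemma second_order_upper_bound:
  "\<exists>A\<ge>0. \<forall>y s. \<bar>s\<bar> \<le> 1 \<longrightarrow>
     b (y + s) \<le> b y + poly (pderiv P) y * s + A * (1 + \<bar>y\<bar>) ^ (2 * n - 2) * s\<^sup>2"
proof -
  have "degree P \<le> 2 * n"
    unfolding P_def using degree_Q by (intro degree_add_le degree_monom_le) auto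
  then have "degree (pderiv (pderiv P)) \<le> 2 * n - 2" by (simp add: degree_pderiv)
  then obtain A where A: "A \<ge> 0"
    "\<And>x. \<bar>poly (pderiv (pderiv P)) x\<bar> \<le> A * (1 + \<bar>x\<bar>) ^ (2 * n - 2)"
    using poly_growth_le by blast
  have "b (y + s) \<le> b y + poly (pderiv P) y * s + A * 2 ^ (2 * n - 2) * (1 + \<bar>y\<bar>) ^ (2 * n - 2) * s\<^sup>2"
    if s: "\<bar>s\<bar> \<le> 1" for y s
  proof -
    have "{min y (y + s)..max y (y + s)} \<subseteq> {y - \<bar>s\<bar>..y + \<bar>s\<bar>}" by auto
    from poly_MVT'[OF this, of P]
    obtain \<xi> where \<xi>: "\<xi> \<in> {y - \<bar>s\<bar>..y + \<bar>s\<bar>}" "poly P (y + s) - poly P y = s * poly (pderiv P) \<xi>"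
      by auto
    have "{min y \<xi>..max y \<xi>} \<subseteq> {y - \<bar>s\<bar>..y + \<bar>s\<bar>}" using \<xi>(1) by auto
    from poly_MVT'[OF this, of "pderiv P"]
    obtain \<zeta> where \<zeta>: "\<zeta> \<in> {y - \<bar>s\<bar>..y + \<bar>s\<bar>}"
      "poly (pderiv P) \<xi> - poly (pderiv P) y = (\<xi> - y) * poly (pderiv (pderiv P)) \<zeta>"
      by blast
    have "b (y + s) - b y - poly (pderiv P) y * s = s * (poly (pderiv P) \<xi> - poly (pderiv P) y)"
      using \<xi>(2) by (simp add: b_eq_poly algebra_simps)
    also have "\<dots> \<le> \<bar>s\<bar> * (\<bar>\<xi> - y\<bar> * \<bar>poly (pderiv (pderiv P)) \<zeta>\<bar>)"
      using abs_ge_self[of "s * ((\<xi> - y) * poly (pderiv (pderiv P)) \<zeta>)"]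
      by (simp only: \<zeta>(2) abs_mult)
    also have "\<dots> \<le> \<bar>s\<bar> * (\<bar>s\<bar> * (A * (2 * (1 + \<bar>y\<bar>)) ^ (2 * n - 2)))"
    proof (intro mult_left_mono mult_mono)
      show "\<bar>\<xi> - y\<bar> \<le> \<bar>s\<bar>" using \<xi>(1) by auto
      have "(1 + \<bar>\<zeta>\<bar>) ^ (2 * n - 2) \<le> (2 * (1 + \<bar>y\<bar>)) ^ (2 * n - 2)"
        using \<zeta>(1) s by (intro power_mono) auto
      then show "\<bar>poly (pderiv (pderiv P)) \<zeta>\<bar> \<le> A * (2 * (1 + \<bar>y\<bar>)) ^ (2 * n - 2)"
        using A(1) by (intro order_trans[OF A(2)] mult_left_mono)
    qed simp_all
    also have "\<dots> = A * 2 ^ (2 * n - 2) * (1 + \<bar>y\<bar>) ^ (2 * n - 2) * s\<^sup>2"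
    proof -
      have "s\<^sup>2 = \<bar>s\<bar> * \<bar>s\<bar>" by (simp add: power2_eq_square)
      then show ?thesis by (simp only: power_mult_distrib mult_ac)
    qed
    finally show ?thesis by simp
  qed
  moreover have "A * 2 ^ (2 * n - 2) \<ge> 0" using A by simp
  ultimately show ?thesis by blast
qed

text \<open>
  Laplace's method from below. Near a maximizer \<open>y\<close> the function \<open>\<eta> x - b x\<close> drops below
  \<open>b\<^sup>*(\<eta>)\<close> by at most \<open>A L ^ (2 n - 2) s\<^sup>2\<close> at distance \<open>s\<close>, where \<open>L = 1 + \<bar>y\<bar>\<close>. On the interval of
  radius \<open>\<rho> = 1 / ((1 + \<tau>) L ^ (n - 1))\<close> this costs only a bounded factor, so \<open>N\<close> is at least of the
  order of \<open>\<rho> exp (2 \<tau> b\<^sup>*(\<eta>))\<close>; and \<open>L ^ (n - 1)\<close> is at most of the order of \<open>sqrt (1 + \<bar>\<eta>\<bar>)\<close> by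
  \<open>maximizer_growth\<close>.
\<close>

lemma N_lower_bound:
  "\<exists>K. \<forall>\<eta> \<tau>. \<tau> > 0 \<longrightarrow>
     exp (2 * \<tau> * legendre b \<eta>) \<le> K * ((1 + \<tau>) * sqrt (1 + \<bar>\<eta>\<bar>)) * N b \<eta> \<tau>"
proof -
  obtain C where C: "C \<ge> 0"
    "\<And>\<eta> y. legendre b \<eta> = \<eta> * y - b y \<Longrightarrow> (1 + \<bar>y\<bar>) ^ (2 * n - 2) \<le> C * (1 + \<bar>\<eta>\<bar>)"
    using maximizer_growth by blast
  obtain A where A: "A \<ge> 0" "\<And>y s. \<bar>s\<bar> \<le> 1 \<Longrightarrow>
     b (y + s) \<le> b y + poly (pderiv P) y * s + A * (1 + \<bar>y\<bar>) ^ (2 * n - 2) * s\<^sup>2"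
    using second_order_upper_bound by blast
  have "exp (2 * \<tau> * legendre b \<eta>)
      \<le> exp (2 * A) / 2 * sqrt C * ((1 + \<tau>) * sqrt (1 + \<bar>\<eta>\<bar>)) * N b \<eta> \<tau>" if \<tau>: "\<tau> > 0" for \<eta> \<tau>
  proof -
    obtain y where y: "legendre b \<eta> = \<eta> * y - b y" using legendre_attained by blast
    define L where "L = 1 + \<bar>y\<bar>"
    have L: "L \<ge> 1" by (simp add: L_def)
    define \<rho> where "\<rho> = 1 / ((1 + \<tau>) * L ^ (n - 1))"
    have L_pow: "L ^ (n - 1) \<ge> 1" using L by simp
    have "(1 + \<tau>) * L ^ (n - 1) \<ge> 1 * 1" using L_pow \<tau> by (intro mult_mono) auto
    then have \<rho>: "\<rho> > 0" "\<rho> \<le> 1" by (auto simp: \<rho>_def)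
    have sq: "L ^ (2 * n - 2) = (L ^ (n - 1))\<^sup>2"
      by (simp add: power_mult[symmetric] right_diff_distrib' mult.commute)
    have "\<tau> * (L ^ (2 * n - 2) * \<rho>\<^sup>2) = \<tau> / (1 + \<tau>)\<^sup>2"
      using L by (simp add: sq \<rho>_def power_divide power_mult_distrib)
    also have "\<dots> \<le> 1" using \<tau> by (simp add: power2_eq_square pos_divide_le_eq algebra_simps add_pos_pos)
    finally have scale: "\<tau> * (L ^ (2 * n - 2) * \<rho>\<^sup>2) \<le> 1" .
    define E where "E = exp (2 * \<tau> * legendre b \<eta>) * exp (- 2 * A)"
    have pointwise: "indicator {y - \<rho>..y + \<rho>} x * E \<le> exp (2 * \<tau> * (\<eta> * x - b x))" for x
    proof (cases "x \<in> {y - \<rho>..y + \<rho>}")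
      case True
      define s where "s = x - y"
      have s: "\<bar>s\<bar> \<le> \<rho>" "x = y + s" using True by (auto simp: s_def)
      have "b x \<le> b y + \<eta> * s + A * L ^ (2 * n - 2) * s\<^sup>2"
        using A(2)[of s y] s \<rho> pderiv_eq_at_maximizer[OF y] by (simp add: L_def)
      also have "\<dots> \<le> b y + \<eta> * s + A * L ^ (2 * n - 2) * \<rho>\<^sup>2"
        using s L A \<rho> by (intro add_left_mono mult_left_mono) (auto simp: abs_le_square_iff[symmetric])
      finally have "legendre b \<eta> - A * L ^ (2 * n - 2) * \<rho>\<^sup>2 \<le> \<eta> * x - b x"
        by (simp add: y s(2) algebra_simps)
      then have "2 * \<tau> * (legendre b \<eta> - A * L ^ (2 * n - 2) * \<rho>\<^sup>2) \<le> 2 * \<tau> * (\<eta> * x - b x)"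
        using \<tau> by (intro mult_left_mono) auto
      moreover have "A * (\<tau> * (L ^ (2 * n - 2) * \<rho>\<^sup>2)) \<le> A * 1"
        using A scale by (intro mult_left_mono) auto
      ultimately have "2 * \<tau> * legendre b \<eta> - 2 * A \<le> 2 * \<tau> * (\<eta> * x - b x)"
        by (simp add: algebra_simps)
      then show ?thesis using True by (simp add: E_def exp_add[symmetric])
    qed simp
    have "(LINT x|lborel. indicator {y - \<rho>..y + \<rho>} x * E) \<le> N b \<eta> \<tau>"
      unfolding N_def
    proof (rule integral_mono)
      show "integrable lborel (\<lambda>x. indicator {y - \<rho>..y + \<rho>} x * E)"
        using \<rho> by (intro integrable_mult_left integrable_real_indicator) auto
    qed (use N_integrable[OF \<tau>] pointwise in auto)
    then have "2 * \<rho> * E \<le> N b \<eta> \<tau>" using \<rho> by simp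
    moreover define W where "W = (1 + \<tau>) * L ^ (n - 1)"
    moreover have "2 * \<rho> * E = 2 * exp (2 * \<tau> * legendre b \<eta>) / (exp (2 * A) * W)"
      by (simp add: E_def \<rho>_def W_def exp_minus divide_inverse)
    moreover have "exp (2 * A) * W > 0" using L \<tau> by (simp add: W_def)
    ultimately have "2 * exp (2 * \<tau> * legendre b \<eta>) \<le> N b \<eta> \<tau> * (exp (2 * A) * W)"
      by (simp only: pos_divide_le_eq)
    then have "exp (2 * \<tau> * legendre b \<eta>) \<le> exp (2 * A) / 2 * N b \<eta> \<tau> * ((1 + \<tau>) * L ^ (n - 1))"
      unfolding W_def[symmetric] by (simp add: mult_ac)
    also have "\<dots> \<le> exp (2 * A) / 2 * N b \<eta> \<tau> * ((1 + \<tau>) * (sqrt C * sqrt (1 + \<bar>\<eta>\<bar>)))"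
    proof (intro mult_left_mono)
      have "L ^ (n - 1) = sqrt (L ^ (2 * n - 2))" using L by (simp add: sq)
      also have "\<dots> \<le> sqrt (C * (1 + \<bar>\<eta>\<bar>))" using C(2)[OF y] by (simp add: L_def)
      finally show "L ^ (n - 1) \<le> sqrt C * sqrt (1 + \<bar>\<eta>\<bar>)" by (simp add: real_sqrt_mult)
      show "0 \<le> exp (2 * A) / 2 * N b \<eta> \<tau>"
        unfolding N_def by (intro mult_nonneg_nonneg Bochner_Integration.integral_nonneg) auto
    qed (use \<tau> in auto)
    finally show ?thesis by (simp add: mult_ac)
  qed
  then show ?thesis by blast
qed

lemma laplace_lower_bound_exists: "\<exists>K. laplace_lower_bound b K"
proof -
  obtain K where K: "\<And>\<eta> \<tau>. \<tau> > 0 \<Longrightarrow>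
     exp (2 * \<tau> * legendre b \<eta>) \<le> K * ((1 + \<tau>) * sqrt (1 + \<bar>\<eta>\<bar>)) * N b \<eta> \<tau>"
    using N_lower_bound by blast
  have "laplace_lower_bound b K" by standard (rule K)
  then show ?thesis ..
qed

end

section \<open>The Szego kernel\<close>

theorem theorem2p3:
  fixes n :: nat and a :: "nat \<Rightarrow> real" and b :: "real \<Rightarrow> real" and c :: complex
  assumes "n \<ge> 2"
    and "b = (\<lambda>x. 1 / (2 * real n) * x ^ (2 * n) + (\<Sum>j = 2..2 * n - 1. a j * x ^ j))"
  shows "(\<forall>p\<in>region b. set_integrable lborel (UNIV \<times> {0<..}) (szego_integrand b p))
    \<and> open (region b)
    \<and> (closure (Omega b) \<times> closure (Omega b)) - Sigma_set b \<subseteq> region b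
    \<and> (\<forall>i1 j1 i2 j2.
          (\<forall>p\<in>region b.
             set_integrable lborel (UNIV \<times> {0<..}) (szego_deriv_integrand b i1 j1 i2 j2 p))
        \<and> (\<forall>p\<in>region b. mixed_deriv i1 j1 i2 j2 (szego c b) differentiable (at p))
        \<and> (\<exists>c'. \<forall>p\<in>region b. mixed_deriv i1 j1 i2 j2 (szego c b) p =
             c' * (LINT q : UNIV \<times> {0<..} | lborel. szego_deriv_integrand b i1 j1 i2 j2 p q)))"
proof -
  define Q where "Q = (\<Sum>j = 2..2 * n - 1. monom (a j) j)"
  have "degree Q \<le> 2 * n - 1"
    unfolding Q_def by (rule degree_sum_le) (auto intro: order_trans[OF degree_monom_le])
  then interpret E: even_degree_polynomial n Q b
    using assms by unfold_locales (auto simp: Q_def poly_sum poly_monom)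
  obtain K where "laplace_lower_bound b K" using E.laplace_lower_bound_exists by blast
  then interpret laplace_lower_bound b K .
  show ?thesis
  proof (intro conjI allI ballI)
    show "set_integrable lborel (UNIV \<times> {0<..}) (szego_integrand b p)" if "p \<in> region b" for p
      unfolding szego_integrand_eq_moment_integrand
      using that by (rule set_integrable_moment_integrand) simp
    show "open (region b)" by (rule E.open_region)
    show "closure (Omega b) \<times> closure (Omega b) - Sigma_set b \<subseteq> region b"
      using E.finite_Lambda_at by (rule E.closure_minus_Sigma_subset_region)
  next
    fix i1 j1 i2 j2
    show "set_integrable lborel (UNIV \<times> {0<..}) (szego_deriv_integrand b i1 j1 i2 j2 p)"
      if "p \<in> region b" for p
      unfolding szego_deriv_integrand_eq_moment_integrand
      using that by (rule set_integrable_moment_integrand) simp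
    show "mixed_deriv i1 j1 i2 j2 (szego c b) differentiable (at p)" if "p \<in> region b" for p
      using that by (rule mixed_deriv_szego_differentiable)
    show "\<exists>c'. \<forall>p\<in>region b. mixed_deriv i1 j1 i2 j2 (szego c b) p =
        c' * (LINT q : UNIV \<times> {0<..} | lborel. szego_deriv_integrand b i1 j1 i2 j2 p q)"
      using mixed_deriv_szego[of _ i1 j1 i2 j2 c]
      unfolding szego_deriv_integrand_eq_moment_integrand moment_def[symmetric] by blast
  qed
qed

end
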